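(* Let $n\ge1$. The sub-Riemannian distance from the north pole to a point of $\mathbb{S}^{4n+3}$ with cylindric coordinates $(r,\eta)$ depends only on $r$ and $\eta$; denote it $d(r,\eta)$. Then: (1) For $\eta\in[0,\pi]$, $d^2(0,\eta)=2\pi\eta-\eta^2$. (2) For $\eta\in[0,\pi]$ and $r\in\left(0,\frac{\pi}{2}\right)$, $$d^2(r,\eta)=\frac{(\varphi(r,\eta)+\eta)^2\tan^2 r}{\sin^2(\varphi(r,\eta))},$$ where $\varphi(r,\eta)$ is the unique solution in $[-\pi,0]$ of $$\varphi(r,\eta)+\eta=\cos r\,\sin\varphi(r,\eta)\,\frac{\arccos(\cos\varphi(r,\eta)\cos r)}{\sqrt{1-\cos^2 r\cos^2\varphi(r,\eta)}}$$ (for $\eta\in\{0,\pi\}$ the right-hand side of the formula for $d^2$ is understood as a limit). In particular, the sub-Riemannian diameter of $\mathbb{S}^{4n+3}$ is $\pi$.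
   Context: $\mathbb{S}^{4n+3}=\{q\in\mathbb{H}^{n+1}:\|q\|=1\}$ ($\mathbb{H}$ the quaternions) with its round metric. The unit quaternions $\mathbf{SU}(2)$ act isometrically by $g\cdot(q_1,\dots,q_{n+1})=(gq_1,\dots,gq_{n+1})$ with quotient $\mathbb{HP}^n$. The horizontal distribution $\mathbf{H}$ is the orthogonal complement, in the tangent bundle of $\mathbb{S}^{4n+3}$, of the tangent spaces to the $\mathbf{SU}(2)$-orbits; the sub-Riemannian distance between two points is the infimum of the lengths (for the round metric) of absolutely continuous curves joining them that are tangent to $\mathbf{H}$ almost everywhere. North pole: $(0,\dots,0,1)$. Cylindric coordinates $(r,\eta)\in[0,\pi/2)\times[0,\pi]$ of a point with $q_{n+1}\ne0$: $|q_{n+1}|=\cos r$, $\mathrm{Re}(q_{n+1})=\cos r\cos\eta$. *)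

theory Defs
  imports "HOL-Analysis.Analysis"
begin

text \<open>Quaternions in scalar-vector form: the pair \<open>(a, u)\<close> stands for
  \<open>a + u\<^sub>1 i + u\<^sub>2 j + u\<^sub>3 k\<close>. The inner product and norm of the product type are the
  usual ones of \<open>\<real>\<^sup>4\<close>, and the real part is \<^const>\<open>fst\<close>.\<close>

type_synonym quat = "real \<times> (real ^ 3)"

definition qmult :: "quat \<Rightarrow> quat \<Rightarrow> quat" where
  "qmult p q = (fst p * fst q - inner (snd p) (snd q),
                fst p *\<^sub>R snd q + fst q *\<^sub>R snd p + cross3 (snd p) (snd q))"

text \<open>\<open>\<H>\<^sup>n\<^sup>+\<^sup>1\<close> with \<open>n = CARD('n)\<close>; the second component is the last
  coordinate \<open>q\<^sub>n\<^sub>+\<^sub>1\<close>. The unit sphere is \<open>sphere 0 1\<close>, and its round metric is the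
  restriction of the ambient inner product.\<close>

type_synonym 'n hspace = "(quat ^ 'n) \<times> quat"

definition qaction :: "quat \<Rightarrow> 'n::finite hspace \<Rightarrow> 'n hspace" where
  "qaction g x = ((\<chi> i. qmult g (fst x $ i)), qmult g (snd x))"

definition qorbit :: "'n::finite hspace \<Rightarrow> 'n hspace set" where
  "qorbit x = {qaction g x | g. norm g = 1}"

definition north_pole :: "'n::finite hspace" where
  "north_pole = (0, (1, 0))"

text \<open>Velocities at \<open>x\<close> of curves in \<open>S\<close> through \<open>x\<close>. For an embedded submanifold this is
  the usual tangent space.\<close>

definition tangent_space :: "'a::real_normed_vector set \<Rightarrow> 'a \<Rightarrow> 'a set" where
  "tangent_space S x =
     {v. \<exists>c::real \<Rightarrow> 'a. range c \<subseteq> S \<and> c 0 = x \<and> (c has_vector_derivative v) (at 0)}"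

definition horizontal_space :: "'n::finite hspace \<Rightarrow> 'n hspace set" where
  "horizontal_space x =
     {v \<in> tangent_space (sphere 0 1) x. \<forall>w \<in> tangent_space (qorbit x) x. inner v w = 0}"

text \<open>Here \<open>D\<close> ranges over the finite families of non-overlapping compact subintervals
  \<open>k = {Inf k..Sup k}\<close> of \<open>I\<close>.\<close>

definition abs_continuous_on :: "real set \<Rightarrow> (real \<Rightarrow> 'a::real_normed_vector) \<Rightarrow> bool" where
  "abs_continuous_on I f \<longleftrightarrow>
     (\<forall>\<epsilon>>0. \<exists>\<delta>>0. \<forall>D. D division_of \<Union>D \<and> \<Union>D \<subseteq> I \<and> (\<Sum>k\<in>D. Sup k - Inf k) < \<delta>
        \<longrightarrow> (\<Sum>k\<in>D. norm (f (Sup k) - f (Inf k))) < \<epsilon>)"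

definition horizontal_curve :: "(real \<Rightarrow> 'n::finite hspace) \<Rightarrow> bool" where
  "horizontal_curve \<gamma> \<longleftrightarrow>
     path_image \<gamma> \<subseteq> sphere 0 1 \<and> abs_continuous_on {0..1} \<gamma> \<and>
     (AE t in lebesgue_on {0..1}.
        \<exists>v \<in> horizontal_space (\<gamma> t). (\<gamma> has_vector_derivative v) (at t within {0..1}))"

text \<open>Absolutely continuous curves are differentiable almost everywhere with integrable
  speed, so this is their length.\<close>

definition curve_length :: "(real \<Rightarrow> 'a::real_normed_vector) \<Rightarrow> real" where
  "curve_length \<gamma> = integral {0..1} (\<lambda>t. norm (vector_derivative \<gamma> (at t within {0..1})))"

text \<open>Extended real values, so that the infimum over an empty set of curves would be
  \<open>\<infinity>\<close>.\<close>

definition sR_dist :: "'n::finite hspace \<Rightarrow> 'n hspace \<Rightarrow> ereal" where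
  "sR_dist x y =
     (INF \<gamma> \<in> {\<gamma>. horizontal_curve \<gamma> \<and> pathstart \<gamma> = x \<and> pathfinish \<gamma> = y}.
        ereal (curve_length \<gamma>))"

definition sR_diameter :: "'n::finite hspace set \<Rightarrow> ereal" where
  "sR_diameter S = (SUP x \<in> S. SUP y \<in> S. sR_dist x y)"

definition cylindric_coords :: "'n::finite hspace \<Rightarrow> real \<Rightarrow> real \<Rightarrow> bool" where
  "cylindric_coords x r \<eta> \<longleftrightarrow>
     r \<in> {0..<pi/2} \<and> \<eta> \<in> {0..pi} \<and>
     norm (snd x) = cos r \<and> fst (snd x) = cos r * cos \<eta>"

definition is_phi :: "real \<Rightarrow> real \<Rightarrow> real \<Rightarrow> bool" where
  "is_phi r \<eta> \<phi> \<longleftrightarrow> \<phi> \<in> {-pi..0} \<and>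
     \<phi> + \<eta> = cos r * sin \<phi> * (arccos (cos \<phi> * cos r) / sqrt (1 - (cos r)\<^sup>2 * (cos \<phi>)\<^sup>2))"

definition phi :: "real \<Rightarrow> real \<Rightarrow> real" where
  "phi r \<eta> = (THE \<phi>. is_phi r \<eta> \<phi>)"

definition dist_sq_formula :: "real \<Rightarrow> real \<Rightarrow> real" where
  "dist_sq_formula r \<eta> = (phi r \<eta> + \<eta>)\<^sup>2 * (tan r)\<^sup>2 / (sin (phi r \<eta>))\<^sup>2"

end

theory Submission
  imports Defs
begin

text \<open>Lower bound. Let \<open>\<gamma>\<close> be a horizontal curve from the north pole with speed \<open>s\<close> and length \<open>L\<close>, let
  \<open>k\<close> be a unit imaginary quaternion and put \<open>S(t) = \<integral>\<^sub>0\<^sup>t s\<close>. Since \<open>\<gamma>'\<close> is orthogonal to \<open>k\<gamma>\<close>, the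
  curve \<open>exp (\<kappa>S(t)k) \<gamma>(t)\<close> on the sphere has speed \<open>sqrt (1 + \<kappa>\<^sup>2) s\<close>, so its length
  \<open>sqrt (1 + \<kappa>\<^sup>2) L\<close> is at least the great circle distance of its end points. With \<open>\<mu> = \<kappa>L\<close> and \<open>k\<close>
  along the imaginary part of the last coordinate this reads
  \<open>L\<^sup>2 \<ge> (arccos (cos r cos (\<eta> + \<mu>)))\<^sup>2 - \<mu>\<^sup>2\<close> for every \<open>\<mu>\<close>. The critical point equation of the right
  hand side in \<open>\<mu>\<close> is the equation defining \<open>\<phi> = - (\<eta> + \<mu>)\<close>, and its value there is \<open>d\<^sup>2\<close>.

  Upper bound. Equality holds when the turned curve is a great circle arc, which gives explicit
  horizontal curves. The same curves, built in a frame adapted to any two points, have length at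
  most \<open>\<pi>\<close>, whence the diameter.\<close>

section \<open>Absolutely continuous curves\<close>

text \<open>Intervals of a division overlap only in boundary points, so integrating the constant 1
  over the union adds up their lengths.\<close>

lemma sum_content_le_measure:
  assumes "D division_of \<Union>D" "\<Union>D \<subseteq> U" "U \<in> lmeasurable"
  shows "(\<Sum>k\<in>D. measure lborel k) \<le> measure lebesgue U"
proof -
  have "((\<lambda>x. 1::real) has_integral (\<Sum>k\<in>D. integral k (\<lambda>x. 1::real))) (\<Union>D)"
    using assms(1) by (intro has_integral_combine_division) (auto dest: division_ofD(4))
  moreover have "(\<Sum>k\<in>D. integral k (\<lambda>x. 1::real)) = (\<Sum>k\<in>D. measure lborel k)"
    using assms(1) by (intro sum.cong refl) (auto dest!: division_ofD(4))
  moreover have D: "\<Union>D \<in> lmeasurable"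
    using assms(1) by (rule lmeasurable_division)
  ultimately have "(\<Sum>k\<in>D. measure lborel k) = measure lebesgue (\<Union>D)"
    using lmeasure_integral[OF D] by (simp add: integral_unique)
  then show ?thesis
    using measure_mono_fmeasurable[OF assms(2) _ assms(3)] D by (simp add: fmeasurableD)
qed

lemma abs_continuous_on_subset:
  "abs_continuous_on I f \<Longrightarrow> J \<subseteq> I \<Longrightarrow> abs_continuous_on J f"
  unfolding abs_continuous_on_def by (meson subset_trans)

text \<open>The gauge integral absorbs the exceptional null set: intervals tagged in it can be confined
  to an open set of small measure, where absolute continuity makes the increments small.\<close>

lemma abs_continuous_has_integral:
  fixes f :: "real \<Rightarrow> 'a::banach"
  assumes ab: "a \<le> b" and ac: "abs_continuous_on {a..b} f" and N: "negligible N"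
    and d: "\<And>t. t \<in> {a..b} - N \<Longrightarrow> (f has_vector_derivative f' t) (at t within {a..b})"
  shows "(f' has_integral f b - f a) {a..b}"
proof -
  \<comment> \<open>With value 0 on \<open>N\<close>, a tag in \<open>N\<close> contributes nothing
    but the increment of \<open>f\<close> over its interval.\<close>
  define g where "g t = (if t \<in> N then 0 else f' t)" for t
  have "(g has_integral f b - f a) {a..b}"
    unfolding has_integral_real
  proof (intro allI impI)
    fix e :: real assume e: "e > 0"
    \<comment> \<open>Half of \<open>e\<close> is for tags outside \<open>N\<close>, spread in
      proportion to length, and half for tags in \<open>N\<close>. The \<open>+ 1\<close> covers
      \<open>a = b\<close>.\<close>
    define e1 where "e1 = e / (2 * (b - a + 1))"
    have e1: "e1 > 0" "e1 * (b - a) < e / 2"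
      using e ab by (auto simp: e1_def field_simps)
    obtain \<delta> where \<delta>: "\<delta> > 0" "\<And>D. D division_of \<Union>D \<Longrightarrow> \<Union>D \<subseteq> {a..b} \<Longrightarrow> (\<Sum>k\<in>D. Sup k - Inf k) < \<delta>
        \<Longrightarrow> (\<Sum>k\<in>D. norm (f (Sup k) - f (Inf k))) < e / 2"
      using ac e unfolding abs_continuous_on_def by (meson half_gt_zero)
    have Nn: "N \<in> null_sets lebesgue" using N by (simp add: negligible_iff_null_sets)
    then obtain U where U: "open U" "N \<subseteq> U" "U - N \<in> lmeasurable" "emeasure lebesgue (U - N) < ennreal \<delta>"
      using sets_lebesgue_outer_open[of N \<delta>] \<delta>(1) by (metis null_setsD2)
    have Ueq: "U = (U - N) \<union> N" using U(2) by auto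
    have Um: "U \<in> lmeasurable"
      using fmeasurable.Un[OF U(3) fmeasurableI_null_sets[OF Nn]] Ueq by simp
    have "measure lebesgue U = measure lebesgue (U - N)"
      using measure_Diff_null_set[OF fmeasurableD[OF Um] Nn] by simp
    also have "\<dots> < \<delta>"
      using U(3,4) \<delta>(1) by (simp add: emeasure_eq_measure2 ennreal_less_iff)
    finally have mU: "measure lebesgue U < \<delta>" .
    \<comment> \<open>One gauge for both kinds of tag: the linear approximation is good near a
      differentiability point, and balls around points of \<open>N\<close> stay inside
      \<open>U\<close>.\<close>
    have "\<exists>r>0. (x \<in> {a..b} - N \<longrightarrow>
         (\<forall>y\<in>{a..b}. norm (y-x) < r \<longrightarrow> norm (f y - f x - (y-x) *\<^sub>R f' x) \<le> e1 * norm (y-x)))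
         \<and> (x \<in> N \<longrightarrow> ball x r \<subseteq> U)" for x
    proof (cases "x \<in> N")
      case True
      then show ?thesis using U(1,2) by (auto simp: open_contains_ball)
    next
      case False
      then show ?thesis
        using d[of x] e1(1) zero_less_one unfolding has_vector_derivative_def has_derivative_within_alt by blast
    qed
    then obtain r where r0: "\<And>x. r x > 0"
      and r1: "\<And>x y. x \<in> {a..b} - N \<Longrightarrow> y \<in> {a..b} \<Longrightarrow> norm (y-x) < r x \<Longrightarrow>
           norm (f y - f x - (y-x) *\<^sub>R f' x) \<le> e1 * norm (y-x)"
      and r2: "\<And>x. x \<in> N \<Longrightarrow> ball x (r x) \<subseteq> U" by metis
    show "\<exists>\<gamma>. gauge \<gamma> \<and> (\<forall>\<D>. \<D> tagged_division_of {a..b} \<and> \<gamma> fine \<D> \<longrightarrow>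
        norm ((\<Sum>(x,k)\<in>\<D>. measure lborel k *\<^sub>R g x) - (f b - f a)) < e)"
    proof (rule exI, safe)
      show "gauge (\<lambda>x. ball x (r x))" using r0 gauge_ball_dependent by blast
    next
      fix p assume p: "p tagged_division_of {a..b}" and fine: "(\<lambda>x. ball x (r x)) fine p"
      note pD = tagged_division_ofD[OF p]
      have iv: "\<exists>u v. K = {u..v} \<and> u \<le> v \<and> a \<le> u \<and> v \<le> b \<and> x \<in> {u..v} \<and> {u..v} \<subseteq> ball x (r x)"
        if xK: "(x, K) \<in> p" for x K
      proof -
        obtain u v where "K = {u..v}" using pD(4)[OF xK] by auto
        with pD(2,3)[OF xK] fineD[OF fine xK] show ?thesis by auto
      qed
      define q where "q = {xk \<in> p. fst xk \<in> N}"
      have qp: "q \<subseteq> p" by (auto simp: q_def)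
      have "q tagged_partial_division_of {a..b}"
        using p tagged_partial_division_subset[OF _ qp] by (auto simp: tagged_division_of_def)
      then have q: "q tagged_division_of \<Union>(snd ` q)"
        by (rule tagged_partial_division_of_Union_self)
      have qd: "snd ` q division_of \<Union>(snd ` q)" by (rule division_of_tagged_division[OF q])
      have qU: "\<Union>(snd ` q) \<subseteq> U"
        using iv r2 by (fastforce simp: q_def)
      have qab: "\<Union>(snd ` q) \<subseteq> {a..b}"
        using iv by (fastforce simp: q_def)
      have "(\<Sum>k\<in>snd ` q. Sup k - Inf k) = (\<Sum>k\<in>snd ` q. measure lborel k)"
        using iv by (intro sum.cong refl) (fastforce simp: q_def)
      also have "\<dots> < \<delta>" using sum_content_le_measure[OF qd qU Um] mU by simp
      finally have small: "(\<Sum>k\<in>snd ` q. norm (f (Sup k) - f (Inf k))) < e / 2"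
        using \<delta>(2)[OF qd qab] by simp
      have fp: "finite p" using pD(1) .
      \<comment> \<open>Passing from tagged pairs to the set of intervals may merge pairs, which is
        harmless only if degenerate intervals have value 0. The empty one needs an explicit 0
        because \<open>Sup {}\<close> and \<open>Inf {}\<close> are unspecified.\<close>
      define h where "h K = (if K = {} then 0 else norm (f (Sup K) - f (Inf K)))" for K
      have h: "h K = norm (f (Sup K) - f (Inf K))" if "(x, K) \<in> p" for x K
        using iv[OF that] by (auto simp: h_def)
      have "(\<Sum>(x,k)\<in>q. h k) = (\<Sum>k\<in>snd ` q. h k)"
        by (rule sum.over_tagged_division_lemma[OF q]) (fastforce simp: h_def)
      moreover have "(\<Sum>(x,k)\<in>q. h k) = (\<Sum>(x,k)\<in>q. norm (f (Sup k) - f (Inf k)))"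
        using qp h by (intro sum.cong refl) auto
      moreover have "(\<Sum>k\<in>snd ` q. h k) = (\<Sum>k\<in>snd ` q. norm (f (Sup k) - f (Inf k)))"
        using qp h by (intro sum.cong refl) auto
      ultimately have badsum: "(\<Sum>(x,k)\<in>q. norm (f (Sup k) - f (Inf k))) = (\<Sum>k\<in>snd ` q. norm (f (Sup k) - f (Inf k)))"
        by simp
      have ba: "b - a = (\<Sum>(x,K)\<in>p. Sup K - Inf K)" "f b - f a = (\<Sum>(x,K)\<in>p. f(Sup K) - f(Inf K))"
        using additive_tagged_division_1[where f= "\<lambda>x. x"] additive_tagged_division_1[where f= f] ab p by auto
      have "norm ((\<Sum>(x,k)\<in>p. measure lborel k *\<^sub>R g x) - (f b - f a))
          = norm (\<Sum>(x,k)\<in>p. measure lborel k *\<^sub>R g x - (f (Sup k) - f (Inf k)))"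
        by (simp add: ba sum_subtractf split_def)
      also have "\<dots> \<le> (\<Sum>(x,k)\<in>p. e1 * (Sup k - Inf k) + (if x \<in> N then norm (f (Sup k) - f (Inf k)) else 0))"
      proof (rule sum_norm_le, safe)
        fix x K assume xK: "(x, K) \<in> p"
        then obtain u v where K: "K = {u..v}" "u \<le> v" "a \<le> u" "v \<le> b" "x \<in> {u..v}" "{u..v} \<subseteq> ball x (r x)"
          using iv by blast
        show "norm (measure lborel K *\<^sub>R g x - (f (Sup K) - f (Inf K))) \<le>
          e1 * (Sup K - Inf K) + (if x \<in> N then norm (f (Sup K) - f (Inf K)) else 0)"
        proof (cases "x \<in> N")
          case True
          then show ?thesis using e1 K by (auto simp: g_def norm_minus_commute)
        next
          case False
          then have xg: "x \<in> {a..b} - N" using K by auto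
          have "u \<in> {u..v}" "v \<in> {u..v}" using K by auto
          then have "u \<in> ball x (r x)" "v \<in> ball x (r x)" using K(6) by blast+
          then have uv: "norm (u - x) < r x" "norm (v - x) < r x" by (auto simp: dist_real_def)
          \<comment> \<open>Both end points are expanded at the tag. As the tag lies between them,
            the two distances add up to the length of the interval.\<close>
          have "norm (measure lborel K *\<^sub>R g x - (f (Sup K) - f (Inf K))) =
             norm (f u - f x - (u - x) *\<^sub>R f' x - (f v - f x - (v - x) *\<^sub>R f' x))"
            using K False by (auto simp: g_def algebra_simps)
          also have "\<dots> \<le> e1 * norm (u - x) + e1 * norm (v - x)"
            using r1[OF xg _ uv(1)] r1[OF xg _ uv(2)] K
              norm_triangle_ineq4[of "f u - f x - (u - x) *\<^sub>R f' x" "f v - f x - (v - x) *\<^sub>R f' x"] by auto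
          also have "\<dots> = e1 * (Sup K - Inf K)" using K by (auto simp: algebra_simps)
          finally show ?thesis using False by simp
        qed
      qed
      also have "\<dots> = e1 * (b - a) + (\<Sum>(x,k)\<in>p. if x \<in> N then norm (f (Sup k) - f (Inf k)) else 0)"
        by (simp add: ba split_def sum.distrib sum_distrib_left)
      also have "(\<Sum>(x,k)\<in>p. if x \<in> N then norm (f (Sup k) - f (Inf k)) else 0) =
          (\<Sum>(x,k)\<in>q. norm (f (Sup k) - f (Inf k)))"
        unfolding q_def sum.inter_filter[OF fp] by (intro sum.cong refl) auto
      finally show "norm ((\<Sum>(x,k)\<in>p. measure lborel k *\<^sub>R g x) - (f b - f a)) < e"
        using small badsum e1 by simp
    qed
  qed
  then show ?thesis
    by (rule has_integral_spike[OF N, rotated]) (simp add: g_def)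
qed

text \<open>On an interval shorter than \<delta> every division has total increment below 1, so the
  indefinite integral has bounded variation there. Finitely many such intervals cover
  \<open>{a..b}\<close>.\<close>

lemma abs_continuous_integrable:
  fixes f :: "real \<Rightarrow> 'a::euclidean_space"
  assumes ac: "abs_continuous_on {a..b} f" and N: "negligible N"
    and d: "\<And>t. t \<in> {a..b} - N \<Longrightarrow> (f has_vector_derivative f' t) (at t within {a..b})"
  shows "f' absolutely_integrable_on {a..b}"
proof -
  obtain \<delta> where \<delta>: "\<delta> > 0" "\<And>D. D division_of \<Union>D \<Longrightarrow> \<Union>D \<subseteq> {a..b} \<Longrightarrow> (\<Sum>k\<in>D. Sup k - Inf k) < \<delta>
        \<Longrightarrow> (\<Sum>k\<in>D. norm (f (Sup k) - f (Inf k))) < 1"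
    using ac unfolding abs_continuous_on_def by (meson zero_less_one)
  have ftc: "(f' has_integral f v - f u) {u..v}" if "u \<le> v" "{u..v} \<subseteq> {a..b}" for u v
    using that by (intro abs_continuous_has_integral[OF _ abs_continuous_on_subset[OF ac] N]
        has_vector_derivative_within_subset[OF d]) auto
  have small: "f' absolutely_integrable_on {u..v}" if uv: "u \<le> v" "{u..v} \<subseteq> {a..b}" "v - u < \<delta>" for u v
    unfolding box_real(2)[symmetric]
  proof (rule bounded_variation_absolutely_integrable_interval[where B = 1])
    show "f' integrable_on cbox u v" using ftc[OF uv(1,2)] by (auto simp: has_integral_iff)
    fix D assume D: "D division_of cbox u v"
    have iv: "\<exists>s t. K = {s..t} \<and> s \<le> t \<and> {s..t} \<subseteq> {a..b}" if "K \<in> D" for K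
      using division_ofD(2-4)[OF D that] uv(2) by force
    have "(\<Sum>K\<in>D. norm (integral K f')) = (\<Sum>k\<in>D. norm (f (Sup k) - f (Inf k)))"
      using iv ftc by (intro sum.cong refl) (fastforce simp: has_integral_iff)
    also have "\<dots> < 1"
    proof (rule \<delta>(2))
      show "D division_of \<Union>D" "\<Union>D \<subseteq> {a..b}" using D uv(2) by (auto simp: division_ofD(6))
      have "(\<Sum>k\<in>D. Sup k - Inf k) = (\<Sum>k\<in>D. measure lborel k)"
        using iv by (intro sum.cong refl) fastforce
      then show "(\<Sum>k\<in>D. Sup k - Inf k) < \<delta>"
        using additive_content_division[OF D] uv by simp
    qed
    finally show "(\<Sum>K\<in>D. norm (integral K f')) \<le> 1" by simp
  qed
  \<comment> \<open>Steps of length \<open>\<delta> / 2\<close> stay strictly below the \<delta>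
    that \<open>small\<close> demands, and \<open>min b\<close> cuts off the last one.\<close>
  have "f' absolutely_integrable_on {a..min b (a + real n * (\<delta> / 2))}" for n
  proof (induction n)
    case 0
    then show ?case
      using small[of a a] \<delta>(1) by (cases "a \<le> b") auto
  next
    case (Suc n)
    let ?c = "min b (a + real n * (\<delta> / 2))" and ?d = "min b (a + real (Suc n) * (\<delta> / 2))"
    show ?case
    proof (cases "a \<le> b")
      case True
      have "?c \<le> ?d" "a \<le> ?c" "?d - ?c < \<delta>" "{?c..?d} \<subseteq> {a..b}"
        using \<delta>(1) True by (auto simp: field_simps min_def)
      then show ?thesis using absolutely_integrable_on_combine[OF Suc small] by blast
    qed (auto simp: min_def)
  qed
  moreover obtain n where "b - a < real n * (\<delta> / 2)"
    using reals_Archimedean3[of "\<delta> / 2"] \<delta>(1) by (meson half_gt_zero)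
  ultimately show ?thesis by (metis add.commute less_diff_eq linorder_not_le min.absorb1 min.strict_order_iff order.asym diff_less_eq less_le_not_le)
qed

text \<open>Makes the explicit geodesics, which have constant speed, admissible curves.\<close>

lemma lipschitz_abs_continuous:
  fixes f :: "real \<Rightarrow> 'a::real_normed_vector"
  assumes "\<And>s t. norm (f t - f s) \<le> C * \<bar>t - s\<bar>"
  shows "abs_continuous_on {a..b} f"
  unfolding abs_continuous_on_def
proof (intro allI impI)
  fix e :: real assume e: "e > 0"
  have C: "C \<ge> 0" using order_trans[OF norm_ge_zero assms[of 1 0]] by simp
  show "\<exists>\<delta>>0. \<forall>D. D division_of \<Union>D \<and> \<Union>D \<subseteq> {a..b} \<and> (\<Sum>k\<in>D. Sup k - Inf k) < \<delta>
        \<longrightarrow> (\<Sum>k\<in>D. norm (f (Sup k) - f (Inf k))) < e"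
  \<comment> \<open>\<open>C + 1\<close> instead of \<open>C\<close> avoids dividing by
    zero.\<close>
  proof (intro exI[of _ "e / (C + 1)"] conjI allI impI; (elim conjE)?)
    show "e / (C + 1) > 0" using e C by simp
    fix D assume D: "D division_of \<Union>D" "(\<Sum>k\<in>D. Sup k - Inf k) < e / (C + 1)"
    have pos: "Sup k - Inf k \<ge> 0" if "k \<in> D" for k
      using division_ofD(3,4)[OF D(1) that] by force
    have "(\<Sum>k\<in>D. norm (f (Sup k) - f (Inf k))) \<le> (\<Sum>k\<in>D. C * (Sup k - Inf k))"
      using assms pos by (intro sum_mono) (metis abs_of_nonneg)
    also have "\<dots> \<le> (C + 1) * (\<Sum>k\<in>D. Sup k - Inf k)"
      unfolding sum_distrib_left[symmetric] using pos by (intro mult_right_mono sum_nonneg) auto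
    also have "\<dots> < e" using D(2) C by (simp add: field_simps)
    finally show "(\<Sum>k\<in>D. norm (f (Sup k) - f (Inf k))) < e" .
  qed
qed

section \<open>Curves orthogonal to a complex structure\<close>

text \<open>The triangle inequality for great circle distance. Cauchy-Schwarz for the parts of
  \<open>x\<close> and \<open>z\<close> orthogonal to \<open>y\<close> bounds
  \<open>inner x z\<close> below by the cosine of the sum of the angles, and \<open>arccos\<close>
  is decreasing. A sum above \<pi> is trivial.\<close>

lemma arccos_inner_triangle:
  fixes x y z :: "'a::real_inner"
  assumes "norm x = 1" "norm y = 1" "norm z = 1"
  shows "arccos (inner x z) \<le> arccos (inner x y) + arccos (inner y z)"
proof -
  have bd: "\<bar>inner u v\<bar> \<le> 1" if "norm u = 1" "norm v = 1" for u v :: 'a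
    using Cauchy_Schwarz_ineq2[of u v] that by simp
  define p q where "p = inner x y" and "q = inner y z"
  have p: "-1 \<le> p" "p \<le> 1" and q: "-1 \<le> q" "q \<le> 1" and xz: "-1 \<le> inner x z" "inner x z \<le> 1"
    using bd[of x y] bd[of y z] bd[of x z] assms by (auto simp: p_def q_def abs_le_iff)
  have n: "inner x x = 1" "inner y y = 1" "inner z z = 1"
    using assms by (simp_all add: dot_square_norm)
  show ?thesis
  proof (cases "arccos p + arccos q \<le> pi")
    case False
    then show ?thesis using arccos_ubound[OF xz] by (simp add: p_def q_def)
  next
    case True
    have "norm (x - p *\<^sub>R y) = sqrt (1 - p\<^sup>2)" "norm (z - q *\<^sub>R y) = sqrt (1 - q\<^sup>2)"
      by (simp_all add: norm_eq_sqrt_inner inner_diff n p_def q_def inner_commute power2_eq_square algebra_simps)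
    then have "\<bar>inner (x - p *\<^sub>R y) (z - q *\<^sub>R y)\<bar> \<le> sqrt (1 - p\<^sup>2) * sqrt (1 - q\<^sup>2)"
      using Cauchy_Schwarz_ineq2[of "x - p *\<^sub>R y" "z - q *\<^sub>R y"] by simp
    then have "- (sqrt (1 - p\<^sup>2) * sqrt (1 - q\<^sup>2)) \<le> inner (x - p *\<^sub>R y) (z - q *\<^sub>R y)"
      by linarith
    also have "\<dots> = inner x z - p * q"
      by (simp add: inner_diff n p_def q_def inner_commute algebra_simps)
    finally have "cos (arccos p + arccos q) \<le> inner x z"
      using p q by (simp add: cos_add sin_arccos)
    then have "arccos (inner x z) \<le> arccos (cos (arccos p + arccos q))"
      using xz by (intro arccos_le_arccos) auto
    also have "\<dots> = arccos p + arccos q"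
      using True arccos_lbound[OF p] arccos_lbound[OF q] by (intro arccos_cos) auto
    finally show ?thesis by (simp add: p_def q_def)
  qed
qed

lemma arccos_inner_chain:
  fixes Y :: "nat \<Rightarrow> 'a::real_inner"
  assumes "\<And>i. i \<le> m \<Longrightarrow> norm (Y i) = 1" "\<And>i. i < m \<Longrightarrow> arccos (inner (Y i) (Y (Suc i))) \<le> d"
  shows "arccos (inner (Y 0) (Y m)) \<le> real m * d"
  using assms
proof (induction m)
  case 0
  then show ?case by (simp add: dot_square_norm)
next
  case (Suc m)
  have "arccos (inner (Y 0) (Y (Suc m))) \<le> arccos (inner (Y 0) (Y m)) + arccos (inner (Y m) (Y (Suc m)))"
    using Suc.prems by (intro arccos_inner_triangle) auto
  also have "\<dots> \<le> real m * d + d" using Suc by (intro add_mono) auto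
  finally show ?case by (simp add: algebra_simps)
qed

text \<open>Models left multiplication by one unit imaginary quaternion; \<open>rot a\<close> is
  then the isometry exp(aJ).\<close>

locale complex_structure =
  fixes J :: "'a::euclidean_space \<Rightarrow> 'a"
  assumes linear: "linear J"
    and J_J: "J (J x) = - x"
    and J_skew: "inner (J x) y = - inner x (J y)"
begin

definition rot :: "real \<Rightarrow> 'a \<Rightarrow> 'a" where
  "rot a x = cos a *\<^sub>R x + sin a *\<^sub>R J x"

lemma J_diff: "J (x - y) = J x - J y"
  using linear by (rule linear_diff)

lemma inner_J_self [simp]: "inner x (J x) = 0"
  using J_skew[of x x] by (simp add: inner_commute)

lemma inner_J_J: "inner (J x) (J y) = inner x y"
  by (simp add: J_skew J_J)

lemma norm_J: "norm (J x) = norm x"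
  by (simp add: norm_eq_sqrt_inner inner_J_J)

lemma inner_rot: "inner (rot a x) (rot b y) = inner x (rot (b - a) y)"
  by (simp add: rot_def inner_add inner_J_J J_skew J_J cos_diff sin_diff algebra_simps)

lemma rot_0 [simp]: "rot 0 x = x"
  by (simp add: rot_def)

lemma norm_rot [simp]: "norm (rot a x) = norm x"
  by (simp add: norm_eq_sqrt_inner inner_rot)

text \<open>Turning a unit-speed curve orthogonal to \<open>J\<close> by \<open>rot (\<kappa>t)\<close> gives it speed
  \<open>sqrt (1 + \<kappa>\<^sup>2)\<close>; this is the corresponding estimate over a parameter interval of length \<open>h\<close>.\<close>

lemma inner_rot_step:
  assumes "norm x = 1" "norm y = 1" "norm (y - x) \<le> h" "\<bar>inner (y - x) (J x)\<bar> \<le> h\<^sup>2"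
    and h: "h\<^sup>2 \<le> 2" "cos (\<kappa> * h) \<ge> 0"
  shows "1 - (1 + \<kappa>\<^sup>2) * h\<^sup>2 / 2 - \<bar>\<kappa>\<bar> * h ^ 3 \<le> inner (rot a x) (rot (a + \<kappa> * h) y)"
proof -
  have n: "inner x x = 1" "inner y y = 1" using assms by (simp_all add: dot_square_norm)
  have h0: "h \<ge> 0" using assms(3) norm_ge_zero order_trans by blast
  have "(norm (y - x))\<^sup>2 = 2 - 2 * inner x y"
    by (simp add: power2_norm_eq_inner inner_diff n inner_commute)
  moreover have "(norm (y - x))\<^sup>2 \<le> h\<^sup>2" using assms(3) by (intro power_mono) auto
  ultimately have xy: "1 - h\<^sup>2 / 2 \<le> inner x y" by simp
  \<comment> \<open>Since \<open>J x\<close> is orthogonal to \<open>x\<close>, near-orthogonality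
    of the increment makes the sine term of third order in \<open>h\<close>.\<close>
  have "inner x (J y) = - inner (y - x) (J x)"
    using J_skew[of x y] by (simp add: inner_diff inner_commute)
  then have "\<bar>sin (\<kappa> * h) * inner x (J y)\<bar> \<le> (\<bar>\<kappa>\<bar> * h) * h\<^sup>2"
    using assms(4) abs_sin_x_le_abs_x[of "\<kappa> * h"] h0
    unfolding abs_mult by (intro mult_mono) (auto simp: abs_mult)
  also have "\<dots> = \<bar>\<kappa>\<bar> * h ^ 3" by (simp add: power2_eq_square power3_eq_cube)
  finally have 1: "- (\<bar>\<kappa>\<bar> * h ^ 3) \<le> sin (\<kappa> * h) * inner x (J y)" by linarith
  have "(sin (\<kappa> * h / 2))\<^sup>2 \<le> (\<kappa> * h / 2)\<^sup>2"
    using abs_sin_x_le_abs_x abs_le_square_iff by blast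
  then have "1 - (\<kappa> * h)\<^sup>2 / 2 \<le> cos (\<kappa> * h)"
    using cos_double_sin[of "\<kappa> * h / 2"] by (simp add: power_divide)
  then have "(1 - (\<kappa> * h)\<^sup>2 / 2) * (1 - h\<^sup>2 / 2) \<le> cos (\<kappa> * h) * (1 - h\<^sup>2 / 2)"
    using h by (intro mult_right_mono) auto
  also have "\<dots> \<le> cos (\<kappa> * h) * inner x y"
    using h xy by (intro mult_left_mono) auto
  finally have "(1 - (\<kappa> * h)\<^sup>2 / 2) * (1 - h\<^sup>2 / 2) \<le> cos (\<kappa> * h) * inner x y" .
  moreover have "1 - (1 + \<kappa>\<^sup>2) * h\<^sup>2 / 2 \<le> (1 - (\<kappa> * h)\<^sup>2 / 2) * (1 - h\<^sup>2 / 2)"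
    by (simp add: algebra_simps power_mult_distrib)
  ultimately show ?thesis
    using 1 by (simp add: inner_rot) (simp add: rot_def inner_add)
qed

text \<open>The curve is sampled at equal increments \<open>h\<close> of \<open>S\<close>. After
  turning, neighbouring samples are at angle at most \<open>C * h\<close> for any \<open>C\<close>
  above \<open>sqrt (1 + \<kappa>\<^sup>2)\<close> once \<open>h\<close> is small; the triangle
  inequality adds these up, and then \<open>C\<close> decreases to its limit. The hypotheses are
  increment estimates, so no derivative of the curve is needed here.\<close>

theorem tilted_curve_bound:
  fixes \<gamma> :: "real \<Rightarrow> 'a" and S :: "real \<Rightarrow> real"
  assumes S: "continuous_on {0..1} S" "S 0 = 0" "\<And>s t. 0 \<le> s \<Longrightarrow> s \<le> t \<Longrightarrow> t \<le> 1 \<Longrightarrow> S s \<le> S t"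
    and unit: "\<And>t. t \<in> {0..1} \<Longrightarrow> norm (\<gamma> t) = 1"
    and lip: "\<And>s t. 0 \<le> s \<Longrightarrow> s \<le> t \<Longrightarrow> t \<le> 1 \<Longrightarrow> norm (\<gamma> t - \<gamma> s) \<le> S t - S s"
    and hor: "\<And>s t. 0 \<le> s \<Longrightarrow> s \<le> t \<Longrightarrow> t \<le> 1 \<Longrightarrow> \<bar>inner (\<gamma> t - \<gamma> s) (J (\<gamma> s))\<bar> \<le> (S t - S s)\<^sup>2"
  shows "arccos (inner (\<gamma> 0) (rot (\<kappa> * S 1) (\<gamma> 1))) \<le> sqrt (1 + \<kappa>\<^sup>2) * S 1"
proof -
  define L where "L = S 1"
  have L: "L \<ge> 0" using S(3)[of 0 1] S(2) by (simp add: L_def)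
  have main: "arccos (inner (\<gamma> 0) (rot (\<kappa> * L) (\<gamma> 1))) \<le> C * L"
    if m: "m > 0" "cos (\<kappa> * (L / real m)) \<ge> 0" "(L / real m)\<^sup>2 \<le> 2" "C \<ge> 0" "C * (L / real m) \<le> pi"
      "cos (C * (L / real m)) \<le> 1 - (1 + \<kappa>\<^sup>2) * (L / real m)\<^sup>2 / 2 - \<bar>\<kappa>\<bar> * (L / real m) ^ 3" for m C
  proof -
    define h where "h = L / real m"
    have h: "h \<ge> 0" "real m * h = L" using L m by (auto simp: h_def)
    have "\<exists>t. t \<in> {0..1} \<and> S t = real i * h" if "i \<le> m" for i
    proof -
      have "real i * h \<le> real m * h" using that h by (intro mult_right_mono) auto
      then have "\<exists>t\<ge>0. t \<le> 1 \<and> S t = real i * h"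
        using h S L by (intro IVT') (auto simp: L_def)
      then show ?thesis by auto
    qed
    then obtain \<tau>0 where \<tau>0: "\<And>i. i \<le> m \<Longrightarrow> \<tau>0 i \<in> {0..1} \<and> S (\<tau>0 i) = real i * h" by metis
    \<comment> \<open>\<open>S\<close> may take the values 0 and \<open>L\<close> at other times
      too, so the end points are fixed by hand.\<close>
    define \<tau> where "\<tau> i = (if i = 0 then 0 else if i = m then 1 else \<tau>0 i)" for i
    have \<tau>: "\<tau> i \<in> {0..1}" "S (\<tau> i) = real i * h" if "i \<le> m" for i
      using \<tau>0[OF that] S(2) h by (auto simp: \<tau>_def L_def)
    have step: "arccos (inner (rot (\<kappa> * (real i * h)) (\<gamma> (\<tau> i)))
        (rot (\<kappa> * (real (Suc i) * h)) (\<gamma> (\<tau> (Suc i))))) \<le> C * h" if "i < m" for i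
    proof -
      have dS: "S (\<tau> (Suc i)) - S (\<tau> i) = h" using \<tau>[of i] \<tau>[of "Suc i"] that by (simp add: algebra_simps)
      have u: "norm (\<gamma> (\<tau> i)) = 1" "norm (\<gamma> (\<tau> (Suc i))) = 1" using \<tau> that unit by auto
      have close: "norm (\<gamma> (\<tau> (Suc i)) - \<gamma> (\<tau> i)) \<le> h \<and> \<bar>inner (\<gamma> (\<tau> (Suc i)) - \<gamma> (\<tau> i)) (J (\<gamma> (\<tau> i)))\<bar> \<le> h\<^sup>2"
      proof (cases "\<tau> i \<le> \<tau> (Suc i)")
        case True
        then show ?thesis using lip[of "\<tau> i" "\<tau> (Suc i)"] hor[of "\<tau> i" "\<tau> (Suc i)"] \<tau>[of i] \<tau>[of "Suc i"] that dS by auto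
      next
        case False
        \<comment> \<open>Sample times in the wrong order are possible only when \<open>S\<close> is
          constant between them, and then so is the curve.\<close>
        then have "h = 0" using S(3)[of "\<tau> (Suc i)" "\<tau> i"] \<tau>[of i] \<tau>[of "Suc i"] that dS h(1) by auto
        moreover have "norm (\<gamma> (\<tau> i) - \<gamma> (\<tau> (Suc i))) \<le> S (\<tau> i) - S (\<tau> (Suc i))"
          using lip[of "\<tau> (Suc i)" "\<tau> i"] False \<tau>[of i] \<tau>[of "Suc i"] that by auto
        ultimately have "\<gamma> (\<tau> (Suc i)) = \<gamma> (\<tau> i)" using dS by auto
        then show ?thesis using \<open>h = 0\<close> by simp
      qed
      have eq: "\<kappa> * (real (Suc i) * h) = \<kappa> * (real i * h) + \<kappa> * h" by (simp add: algebra_simps)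
      have "cos (C * h) \<le> inner (rot (\<kappa> * (real i * h)) (\<gamma> (\<tau> i))) (rot (\<kappa> * (real (Suc i) * h)) (\<gamma> (\<tau> (Suc i))))"
        using inner_rot_step[OF u, of h \<kappa> "\<kappa> * (real i * h)"] close m unfolding eq h_def[symmetric] by linarith
      moreover have "inner (rot (\<kappa> * (real i * h)) (\<gamma> (\<tau> i))) (rot (\<kappa> * (real (Suc i) * h)) (\<gamma> (\<tau> (Suc i)))) \<le> 1"
        using norm_cauchy_schwarz[of "rot (\<kappa> * (real i * h)) (\<gamma> (\<tau> i))" "rot (\<kappa> * (real (Suc i) * h)) (\<gamma> (\<tau> (Suc i)))"] u by simp
      ultimately have "arccos (inner (rot (\<kappa> * (real i * h)) (\<gamma> (\<tau> i))) (rot (\<kappa> * (real (Suc i) * h)) (\<gamma> (\<tau> (Suc i)))))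
          \<le> arccos (cos (C * h))" by (intro arccos_le_arccos) auto
      also have "\<dots> = C * h" using m h by (intro arccos_cos) (auto simp flip: h_def)
      finally show ?thesis .
    qed
    have "arccos (inner (rot (\<kappa> * (real 0 * h)) (\<gamma> (\<tau> 0))) (rot (\<kappa> * (real m * h)) (\<gamma> (\<tau> m)))) \<le> real m * (C * h)"
      by (rule arccos_inner_chain[where Y = "\<lambda>i. rot (\<kappa> * (real i * h)) (\<gamma> (\<tau> i))"]) (use step \<tau> unit in auto)
    moreover have "real m * (C * h) = C * L" using h by (simp add: algebra_simps)
    ultimately show ?thesis using m h by (simp add: \<tau>_def)
  qed
  have "arccos (inner (\<gamma> 0) (rot (\<kappa> * L) (\<gamma> 1))) \<le> C * L" if C: "C > sqrt (1 + \<kappa>\<^sup>2)" for C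
  proof -
    have C0: "C > 0" by (rule le_less_trans[OF _ C]) simp
    have C2: "C\<^sup>2 > 1 + \<kappa>\<^sup>2" using real_sqrt_less_iff[of "1 + \<kappa>\<^sup>2" "C\<^sup>2"] C C0 by simp
    show ?thesis
    proof (cases "L = 0")
      \<comment> \<open>For \<open>L = 0\<close> a single step satisfies all side conditions of
        \<open>main\<close>.\<close>
      case True
      then show ?thesis using main[of 1 C] C0 by simp
    next
      case False
      have "((\<lambda>h. sin (C * h / 2)) has_real_derivative C / 2) (at 0)"
        by (auto intro!: derivative_eq_intros)
      then have lim: "(\<lambda>h. sin (C * h / 2) / h) \<midarrow>0\<rightarrow> C / 2"
        by (simp add: DERIV_def)
      \<comment> \<open>As cos(Ch) = 1 - 2 sin(Ch/2)^2, the last side condition of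
        \<open>main\<close>, divided by \<open>h\<^sup>2\<close>, asks that this expression be
        nonnegative. Its limit is positive because \<open>C\<^sup>2\<close> exceeds
        \<open>1 + \<kappa>\<^sup>2\<close>.\<close>
      have "((\<lambda>h. 2 * (sin (C * h / 2) / h)\<^sup>2 - (1 + \<kappa>\<^sup>2) / 2 - \<bar>\<kappa>\<bar> * h) \<longlongrightarrow>
          2 * (C / 2)\<^sup>2 - (1 + \<kappa>\<^sup>2) / 2 - \<bar>\<kappa>\<bar> * 0) (at 0)"
        by (intro tendsto_intros lim)
      moreover have "2 * (C / 2)\<^sup>2 - (1 + \<kappa>\<^sup>2) / 2 - \<bar>\<kappa>\<bar> * 0 > 0"
        using C2 by (simp add: power_divide)
      ultimately have e1: "\<forall>\<^sub>F h in at 0. 2 * (sin (C * h / 2) / h)\<^sup>2 - (1 + \<kappa>\<^sup>2) / 2 - \<bar>\<kappa>\<bar> * h > 0"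
        by (rule order_tendstoD(1))
      have "((\<lambda>h. cos (\<kappa> * h)) \<longlongrightarrow> 1) (at 0)" "((\<lambda>h. h\<^sup>2) \<longlongrightarrow> (0::real)) (at 0)"
        "((\<lambda>h. C * h) \<longlongrightarrow> 0) (at 0)"
        by (auto intro!: tendsto_eq_intros)
      from order_tendstoD(1)[OF this(1), of 0] order_tendstoD(2)[OF this(2), of 2] order_tendstoD(2)[OF this(3), of pi]
      have e2: "\<forall>\<^sub>F h in at 0. cos (\<kappa> * h) > 0" "\<forall>\<^sub>F h in at 0. h\<^sup>2 < (2::real)" "\<forall>\<^sub>F h in at 0. C * h < pi"
        by auto
      have "((\<lambda>m. L / real m) \<longlongrightarrow> 0) sequentially" by (rule lim_const_over_n)
      then have fl: "filterlim (\<lambda>m. L / real m) (at 0) sequentially"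
        using False by (intro filterlim_atI) (auto intro!: eventually_sequentiallyI[of 1])
      have "\<forall>\<^sub>F m in sequentially. m > 0 \<and> cos (\<kappa> * (L / real m)) > 0 \<and> (L / real m)\<^sup>2 < 2 \<and> C * (L / real m) < pi
         \<and> 2 * (sin (C * (L / real m) / 2) / (L / real m))\<^sup>2 - (1 + \<kappa>\<^sup>2) / 2 - \<bar>\<kappa>\<bar> * (L / real m) > 0"
        using eventually_compose_filterlim[OF e1 fl] eventually_compose_filterlim[OF e2(1) fl]
          eventually_compose_filterlim[OF e2(2) fl] eventually_compose_filterlim[OF e2(3) fl] eventually_gt_at_top[of 0]
        by eventually_elim auto
      then obtain m where m: "m > 0" "cos (\<kappa> * (L / real m)) > 0" "(L / real m)\<^sup>2 < 2" "C * (L / real m) < pi"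
         "2 * (sin (C * (L / real m) / 2) / (L / real m))\<^sup>2 - (1 + \<kappa>\<^sup>2) / 2 - \<bar>\<kappa>\<bar> * (L / real m) > 0"
        using eventually_happens'[OF sequentially_bot] by blast
      define h where "h = L / real m"
      have h: "h > 0" using False L m(1) by (simp add: h_def)
      have "0 < (2 * (sin (C * h / 2) / h)\<^sup>2 - (1 + \<kappa>\<^sup>2) / 2 - \<bar>\<kappa>\<bar> * h) * h\<^sup>2"
        using m(5) h by (simp add: h_def[symmetric])
      also have "\<dots> = 2 * (sin (C * h / 2))\<^sup>2 - (1 + \<kappa>\<^sup>2) * h\<^sup>2 / 2 - \<bar>\<kappa>\<bar> * h ^ 3"
        using h by (simp add: field_simps power2_eq_square power3_eq_cube)
      finally have "cos (C * h) \<le> 1 - (1 + \<kappa>\<^sup>2) * h\<^sup>2 / 2 - \<bar>\<kappa>\<bar> * h ^ 3"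
        using cos_double_sin[of "C * h / 2"] by simp
      then show ?thesis using main[of m C] m C0 by (simp add: h_def)
    qed
  qed
  then have "\<forall>\<^sub>F C in at_right (sqrt (1 + \<kappa>\<^sup>2)). arccos (inner (\<gamma> 0) (rot (\<kappa> * L) (\<gamma> 1))) \<le> C * L"
    by (auto simp: eventually_at_filter)
  moreover have "((\<lambda>C. C * L) \<longlongrightarrow> sqrt (1 + \<kappa>\<^sup>2) * L) (at_right (sqrt (1 + \<kappa>\<^sup>2)))"
    by (intro tendsto_intros)
  ultimately show ?thesis
    unfolding L_def[symmetric] by (intro tendsto_lowerbound[where F = "at_right (sqrt (1 + \<kappa>\<^sup>2))"]) auto
qed

end

section \<open>The quaternionic sphere\<close>

lemma inner_quat: "inner p q = fst p * fst q + inner (snd p) (snd q)" for p q :: quat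
  by (simp add: inner_prod_def)

lemma qmult_components:
  "fst (qmult p q) = fst p * fst q - (snd p $ 1 * snd q $ 1 + snd p $ 2 * snd q $ 2 + snd p $ 3 * snd q $ 3)"
  "snd (qmult p q) $ 1 = fst p * snd q $ 1 + fst q * snd p $ 1 + (snd p $ 2 * snd q $ 3 - snd p $ 3 * snd q $ 2)"
  "snd (qmult p q) $ 2 = fst p * snd q $ 2 + fst q * snd p $ 2 + (snd p $ 3 * snd q $ 1 - snd p $ 1 * snd q $ 3)"
  "snd (qmult p q) $ 3 = fst p * snd q $ 3 + fst q * snd p $ 3 + (snd p $ 1 * snd q $ 2 - snd p $ 2 * snd q $ 1)"
  by (simp_all add: qmult_def cross3_def inner_vec_def sum_3)

lemma quat_eq_iff:
  "p = q \<longleftrightarrow> fst p = fst q \<and> snd p $ 1 = snd q $ 1 \<and> snd p $ 2 = snd q $ 2 \<and> snd p $ 3 = snd q $ 3" for p q :: quat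
  by (auto simp: prod_eq_iff vec_eq_iff forall_3)

lemma inner_quat_components:
  "inner p q = fst p * fst q + (snd p $ 1 * snd q $ 1 + snd p $ 2 * snd q $ 2 + snd p $ 3 * snd q $ 3)" for p q :: quat
  by (simp add: inner_quat inner_vec_def sum_3)

lemma qmult_assoc: "qmult (qmult p q) r = qmult p (qmult q r)"
  by (simp add: quat_eq_iff qmult_components algebra_simps)

lemma qmult_add_left: "qmult (p + q) r = qmult p r + qmult q r"
  and qmult_add_right: "qmult p (q + r) = qmult p q + qmult p r"
  and qmult_scale_left: "qmult (c *\<^sub>R p) r = c *\<^sub>R qmult p r"
  and qmult_scale_right: "qmult p (c *\<^sub>R r) = c *\<^sub>R qmult p r"
  and qmult_1_right: "qmult p (1, 0) = p"
  by (simp_all add: quat_eq_iff qmult_components algebra_simps)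

definition qcnj :: "quat \<Rightarrow> quat" where
  "qcnj q = (fst q, - snd q)"

lemma inner_qmult: "inner (qmult g p) q = inner p (qmult (qcnj g) q)"
  by (simp add: inner_quat_components qmult_components qcnj_def algebra_simps)

lemma inner_qmult_right: "inner (qmult p g) q = inner p (qmult q (qcnj g))"
  by (simp add: inner_quat_components qmult_components qcnj_def algebra_simps)

lemma qmult_qcnj: "qmult q (qcnj q) = (inner q q, 0)" "qmult (qcnj q) q = (inner q q, 0)"
  by (simp_all add: quat_eq_iff inner_quat_components qmult_components qcnj_def algebra_simps)

lemma qmult_scalar: "qmult (a, 0) q = a *\<^sub>R q" "qmult q (a, 0) = a *\<^sub>R q"
  by (simp_all add: quat_eq_iff qmult_components)

section \<open>Left multiplication by quaternions on the ambient space\<close>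

lemma qaction_qaction: "qaction g (qaction h x) = qaction (qmult g h) x"
  by (simp add: qaction_def qmult_assoc)

lemma qaction_scalar: "qaction (a, 0) x = a *\<^sub>R x"
  by (simp add: qaction_def prod_eq_iff vec_eq_iff qmult_scalar)

lemma qaction_add_left: "qaction (g + h) x = qaction g x + qaction h x"
  and qaction_add_right: "qaction g (x + y) = qaction g x + qaction g y"
  and qaction_scale_left: "qaction (c *\<^sub>R g) x = c *\<^sub>R qaction g x"
  and qaction_scale_right: "qaction g (c *\<^sub>R x) = c *\<^sub>R qaction g x"
  by (simp_all add: qaction_def prod_eq_iff vec_eq_iff qmult_add_left qmult_add_right qmult_scale_left qmult_scale_right)

lemma inner_qaction: "inner (qaction g x) y = inner x (qaction (qcnj g) y)"
  by (simp add: qaction_def inner_prod_def[of "(_, _)"] inner_prod_def[of x] inner_vec_def inner_qmult)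

text \<open>The quaternionic Hermitian product. For a unit vector \<open>x\<close> it is the
  coefficient of the orthogonal projection of \<open>y\<close> onto the quaternionic line through
  \<open>x\<close>.\<close>

definition qinner :: "'n::finite hspace \<Rightarrow> 'n hspace \<Rightarrow> quat" where
  "qinner y x = (\<Sum>i\<in>UNIV. qmult (fst y $ i) (qcnj (fst x $ i))) + qmult (snd y) (qcnj (snd x))"

lemma inner_qaction_left: "inner (qaction g x) y = inner g (qinner y x)"
  by (simp add: qaction_def qinner_def inner_prod_def[of "(_, _)"] inner_vec_def inner_qmult_right
      inner_add_right inner_sum_right)

text \<open>A quaternion times its conjugate is real, so moving the right factors to one side leaves
  only a real scalar.\<close>

lemma inner_qaction_qaction: "inner (qaction g x) (qaction h x) = inner g h * inner x x"
proof -
  have "inner (qaction g x) (qaction h x) = (\<Sum>i\<in>UNIV. inner g h * inner (fst x $ i) (fst x $ i)) + inner g h * inner (snd x) (snd x)"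
    by (simp add: qaction_def inner_prod_def[of "(_, _)"] inner_vec_def inner_qmult_right qmult_assoc qmult_qcnj qmult_scalar mult.commute)
  then show ?thesis
    by (simp add: inner_prod_def[of x] inner_vec_def sum_distrib_left distrib_left mult.commute)
qed

lemma norm_qaction: "norm (qaction g x) = norm g * norm x"
  by (simp add: norm_eq_sqrt_inner inner_qaction_qaction real_sqrt_mult)

lemma complex_structure_qaction:
  assumes "norm k = 1"
  shows "complex_structure (qaction (0, k) :: 'n::finite hspace \<Rightarrow> 'n hspace)"
proof (rule complex_structure.intro)
  have k: "inner k k = 1" using assms by (simp add: dot_square_norm)
  show "linear (qaction (0, k) :: 'n hspace \<Rightarrow> 'n hspace)"
    by (rule linearI) (simp_all add: qaction_add_right qaction_scale_right)
  have kk: "qmult (0, k) (0, k) = (-1, 0)"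
    using k by (simp add: qmult_def)
  show "qaction (0, k) (qaction (0, k) x) = - x" for x :: "'n hspace"
    by (simp add: qaction_qaction kk qaction_scalar)
  have "qcnj (0, k) = (-1) *\<^sub>R (0, k)" by (simp add: qcnj_def)
  then show "inner (qaction (0, k) x) y = - inner x (qaction (0, k) y)" for x y :: "'n hspace"
    by (simp only: inner_qaction qaction_scale_left) simp
qed

text \<open>The curve exp(tk)x stays in the orbit and has velocity kx at t = 0.\<close>

lemma horizontal_space_orthogonal:
  assumes v: "v \<in> horizontal_space x" and x: "norm x = 1" and k: "norm k = 1"
  shows "inner v (qaction (0, k) x) = 0"
proof -
  define c where "c t = qaction (cos t, sin t *\<^sub>R k) x" for t :: real
  have ceq: "c t = cos t *\<^sub>R x + sin t *\<^sub>R qaction (0, k) x" for t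
    using qaction_add_left[of "(cos t, 0)" "sin t *\<^sub>R (0, k)" x]
    by (simp only: c_def qaction_scale_left qaction_scalar) simp
  have "norm (cos t, sin t *\<^sub>R k) = 1" for t
    using k by (simp add: norm_Pair)
  then have "range c \<subseteq> qorbit x" by (auto simp: c_def qorbit_def)
  moreover have "c 0 = x" by (simp add: ceq)
  moreover have "(c has_vector_derivative qaction (0, k) x) (at 0)"
    unfolding ceq[abs_def] by (auto intro!: derivative_eq_intros simp: has_vector_derivative_def)
  ultimately have "qaction (0, k) x \<in> tangent_space (qorbit x) x"
    unfolding tangent_space_def by blast
  then show ?thesis using v by (simp add: horizontal_space_def)
qed

text \<open>If \<open>v\<close> is orthogonal to all multiples of the point, its inner product with
  any curve in the orbit is identically 0, hence so is the derivative. The tangent space of the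
  orbit need not be computed.\<close>

lemma in_horizontal_space:
  fixes \<gamma> :: "real \<Rightarrow> 'n::finite hspace"
  assumes sph: "\<And>t. norm (\<gamma> t) = 1" and d: "(\<gamma> has_vector_derivative v) (at t)"
    and orth: "\<And>g. inner (qaction g (\<gamma> t)) v = 0"
  shows "v \<in> horizontal_space (\<gamma> t)"
proof -
  have shift: "((\<lambda>s. t + s) has_vector_derivative 1) (at 0)"
    unfolding has_real_derivative_iff_has_vector_derivative[symmetric] by (auto intro!: derivative_eq_intros)
  have "((\<lambda>s. \<gamma> (t + s)) has_vector_derivative v) (at 0)"
    using vector_diff_chain_at[of "\<lambda>s. t + s" 1 0 \<gamma> v] shift d by (simp add: o_def)
  then have "v \<in> tangent_space (sphere 0 1) (\<gamma> t)"
    unfolding tangent_space_def using sph by (auto intro!: exI[of _ "\<lambda>s. \<gamma> (t + s)"])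
  moreover have "inner v w = 0" if w: "w \<in> tangent_space (qorbit (\<gamma> t)) (\<gamma> t)" for w
  proof -
    obtain c where c: "range c \<subseteq> qorbit (\<gamma> t)" "(c has_vector_derivative w) (at 0)"
      using w by (auto simp: tangent_space_def)
    have "inner v (c s) = 0" for s
    proof -
      have "c s \<in> qorbit (\<gamma> t)" using c(1) by auto
      then obtain g where "c s = qaction g (\<gamma> t)" unfolding qorbit_def by blast
      then show ?thesis using orth[of g] by (simp add: inner_commute)
    qed
    moreover have "((\<lambda>s. inner v (c s)) has_vector_derivative inner v w) (at 0)"
      using bounded_linear.has_vector_derivative[OF bounded_linear_inner_right c(2)] .
    ultimately show ?thesis
      using vector_derivative_unique_at[of "\<lambda>s. 0::real" _ 0 0] by simp
  qed
  ultimately show ?thesis by (simp add: horizontal_space_def)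
qed


text \<open>Supplies \<open>tilted_curve_bound\<close> with the arc length \<open>S\<close>. Both
  increment estimates come from writing increments of the curve as integrals of its
  velocity.\<close>

theorem horizontal_curve_bound:
  fixes \<gamma> :: "real \<Rightarrow> 'n::finite hspace"
  assumes h: "horizontal_curve \<gamma>" and k: "norm k = 1"
  shows "curve_length \<gamma> \<ge> 0"
    "arccos (inner (\<gamma> 0) (qaction (cos (\<kappa> * curve_length \<gamma>), sin (\<kappa> * curve_length \<gamma>) *\<^sub>R k) (\<gamma> 1)))
      \<le> sqrt (1 + \<kappa>\<^sup>2) * curve_length \<gamma>"
proof -
  interpret complex_structure "qaction (0, k) :: 'n hspace \<Rightarrow> 'n hspace"
    by (rule complex_structure_qaction[OF k])
  let ?J = "qaction (0, k) :: 'n hspace \<Rightarrow> 'n hspace"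
  have unit: "norm (\<gamma> t) = 1" if "t \<in> {0..1}" for t
    using h that by (fastforce simp: horizontal_curve_def path_image_def)
  have ac: "abs_continuous_on {0..1} \<gamma>" using h by (simp add: horizontal_curve_def)
  define v where "v t = vector_derivative \<gamma> (at t within {0..1})" for t
  have "AE t in lebesgue_on {0..1}. \<exists>v \<in> horizontal_space (\<gamma> t). (\<gamma> has_vector_derivative v) (at t within {0..1})"
    using h by (simp add: horizontal_curve_def)
  then have "AE t in lebesgue. t \<in> {0..1} \<longrightarrow> (\<exists>v \<in> horizontal_space (\<gamma> t). (\<gamma> has_vector_derivative v) (at t within {0..1}))"
    by (simp add: AE_restrict_space_iff)
  then obtain N where N: "negligible N"
    "\<And>t. t \<in> {0..1} - N \<Longrightarrow> \<exists>v \<in> horizontal_space (\<gamma> t). (\<gamma> has_vector_derivative v) (at t within {0..1})"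
    unfolding eventually_ae_filter_negligible by blast
  have v: "(\<gamma> has_vector_derivative v t) (at t within {0..1})" "inner (v t) (?J (\<gamma> t)) = 0" if t: "t \<in> {0..1} - N" for t
  proof -
    obtain u where u: "u \<in> horizontal_space (\<gamma> t)" "(\<gamma> has_vector_derivative u) (at t within {0..1})"
      using N(2)[OF t] by blast
    have "v t = u"
      unfolding v_def using t u(2) by (intro vector_derivative_within_closed_interval) auto
    then show "(\<gamma> has_vector_derivative v t) (at t within {0..1})" "inner (v t) (?J (\<gamma> t)) = 0"
      using u horizontal_space_orthogonal[OF u(1) _ k] unit[of t] t by auto
  qed
  define s where "s t = norm (v t)" for t
  have vi: "v absolutely_integrable_on {0..1}"
    using abs_continuous_integrable[OF ac N(1) v(1)] by simp
  then have si: "s integrable_on {0..1}"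
    unfolding s_def by (auto simp: absolutely_integrable_on_def)
  have sub: "{a..b} \<subseteq> {0..1}" if "0 \<le> a" "b \<le> 1" for a b :: real using that by auto
  have si': "s integrable_on {a..b}" if "0 \<le> a" "b \<le> 1" for a b
    using integrable_on_subinterval[OF si sub[OF that]] .
  define S where "S t = integral {0..t} s" for t
  have Sdiff: "S b - S a = integral {a..b} s" if "0 \<le> a" "a \<le> b" "b \<le> 1" for a b
    using Henstock_Kurzweil_Integration.integral_combine[of 0 a b s] that si'[of 0 b] by (simp add: S_def)
  have Smono: "S a \<le> S b" if "0 \<le> a" "a \<le> b" "b \<le> 1" for a b
  proof -
    have "0 \<le> integral {a..b} s"
      by (rule Henstock_Kurzweil_Integration.integral_nonneg[OF si']) (use that in \<open>auto simp: s_def\<close>)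
    then show ?thesis using Sdiff[OF that] by simp
  qed
  have ftc: "(v has_integral \<gamma> b - \<gamma> a) {a..b}" if "0 \<le> a" "a \<le> b" "b \<le> 1" for a b
  proof (rule abs_continuous_has_integral[OF that(2) abs_continuous_on_subset[OF ac] N(1)])
    show "{a..b} \<subseteq> {0..1}" using sub that by simp
    then show "(\<gamma> has_vector_derivative v t) (at t within {a..b})" if "t \<in> {a..b} - N" for t
      using that has_vector_derivative_within_subset[OF v(1)] by blast
  qed
  have lip: "norm (\<gamma> b - \<gamma> a) \<le> S b - S a" if "0 \<le> a" "a \<le> b" "b \<le> 1" for a b
  proof -
    have "norm (integral {a..b} v) \<le> integral {a..b} s"
      using ftc[OF that] si'[of a b] that by (intro integral_norm_bound_integral) (auto simp: s_def)
    then show ?thesis using ftc[OF that] Sdiff[OF that] by (simp add: integral_unique)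
  qed
  have hor: "\<bar>inner (\<gamma> b - \<gamma> a) (?J (\<gamma> a))\<bar> \<le> (S b - S a)\<^sup>2" if ab: "0 \<le> a" "a \<le> b" "b \<le> 1" for a b
  proof -
    \<comment> \<open>Horizontality is known only off \<open>N\<close>, so the integrand is set to 0
      there before it is bounded pointwise.\<close>
    let ?f = "\<lambda>t. if t \<in> N then 0 else inner (v t) (?J (\<gamma> a))"
    have "((\<lambda>t. inner (v t) (?J (\<gamma> a))) has_integral inner (\<gamma> b - \<gamma> a) (?J (\<gamma> a))) {a..b}"
      using has_integral_linear[OF ftc[OF ab] bounded_linear_inner_left] by (simp add: o_def)
    then have f: "(?f has_integral inner (\<gamma> b - \<gamma> a) (?J (\<gamma> a))) {a..b}"
      by (rule has_integral_spike[OF N(1), rotated]) auto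
    have "norm (?f t) \<le> (S b - S a) * s t" if t: "t \<in> {a..b}" for t
    proof (cases "t \<in> N")
      case False
      \<comment> \<open>The velocity is orthogonal to \<open>J\<close> at the moving point, so only
        the displacement from \<open>\<gamma> a\<close> counts. It is at most
        \<open>S b - S a\<close>, which gives the second factor of the square.\<close>
      have "inner (v t) (?J (\<gamma> a)) = - inner (v t) (?J (\<gamma> t - \<gamma> a))"
        using v(2)[of t] False t ab by (simp add: J_diff inner_diff)
      then have "\<bar>inner (v t) (?J (\<gamma> a))\<bar> \<le> norm (v t) * norm (\<gamma> t - \<gamma> a)"
        using Cauchy_Schwarz_ineq2[of "v t" "?J (\<gamma> t - \<gamma> a)"] by (simp add: norm_J)
      also have "\<dots> \<le> norm (v t) * (S b - S a)"
        using lip[of a t] Smono[of t b] t ab by (intro mult_left_mono) auto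
      finally show ?thesis using False by (simp add: s_def mult.commute)
    qed (use Smono[of a b] ab in \<open>simp add: s_def\<close>)
    then have "norm (integral {a..b} ?f) \<le> integral {a..b} (\<lambda>t. (S b - S a) * s t)"
      using f integrable_cmul[OF si', of a b "S b - S a"] ab
      by (intro integral_norm_bound_integral) auto
    also have "\<dots> = (S b - S a)\<^sup>2"
      using Sdiff[OF ab] by (simp add: power2_eq_square)
    finally show ?thesis using f by (simp add: integral_unique)
  qed
  have S1: "S 1 = curve_length \<gamma>"
    by (simp add: S_def curve_length_def s_def[abs_def] v_def)
  have "continuous_on {0..1} S"
    unfolding S_def by (rule indefinite_integral_continuous_1[OF si])
  moreover have S0: "S 0 = 0" by (simp add: S_def)
  ultimately have "arccos (inner (\<gamma> 0) (rot (\<kappa> * S 1) (\<gamma> 1))) \<le> sqrt (1 + \<kappa>\<^sup>2) * S 1"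
    using Smono unit lip hor by (intro tilted_curve_bound) auto
  moreover have "rot a x = qaction (cos a, sin a *\<^sub>R k) x" for a x
    using qaction_add_left[of "(cos a, 0)" "sin a *\<^sub>R (0, k)" x]
    by (simp only: rot_def qaction_scale_left qaction_scalar) simp
  ultimately show "arccos (inner (\<gamma> 0) (qaction (cos (\<kappa> * curve_length \<gamma>), sin (\<kappa> * curve_length \<gamma>) *\<^sub>R k) (\<gamma> 1)))
      \<le> sqrt (1 + \<kappa>\<^sup>2) * curve_length \<gamma>"
    by (simp add: S1)
  show "curve_length \<gamma> \<ge> 0" using Smono[of 0 1] S0 S1 by simp
qed

section \<open>The equation for \<open>\<phi>\<close>\<close>

text \<open>The great circle distance from the north pole to a point with cylindric coordinates
  \<open>(r, - \<phi>)\<close>.\<close>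

definition lift_angle :: "real \<Rightarrow> real \<Rightarrow> real" where
  "lift_angle r \<phi> = arccos (cos \<phi> * cos r)"

text \<open>Isolates \<eta>: the equation for \<phi> becomes
  \<open>phi_map r \<phi> = - \<eta>\<close>, so existence and uniqueness follow from
  monotonicity.\<close>

definition phi_map :: "real \<Rightarrow> real \<Rightarrow> real" where
  "phi_map r \<phi> = \<phi> - cos r * sin \<phi> * (lift_angle r \<phi> / sqrt (1 - (cos r)\<^sup>2 * (cos \<phi>)\<^sup>2))"

lemma is_phi_iff: "is_phi r \<eta> \<phi> \<longleftrightarrow> \<phi> \<in> {-pi..0} \<and> phi_map r \<phi> = - \<eta>"
  by (auto simp: is_phi_def phi_map_def lift_angle_def)

lemma abs_cos_less_1:
  assumes "r \<in> {0<..<pi/2}"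
  shows "0 < cos r" "cos r < 1" "\<bar>cos \<phi> * cos r\<bar> < 1"
proof -
  show r: "0 < cos r" "cos r < 1"
    using assms cos_monotone_0_pi[of 0 r] by (auto intro: cos_gt_zero)
  have "\<bar>cos \<phi> * cos r\<bar> \<le> 1 * cos r"
    using r abs_cos_le_one[of \<phi>] by (simp add: abs_mult)
  then show "\<bar>cos \<phi> * cos r\<bar> < 1" using r by linarith
qed

lemma lift_angle_facts:
  assumes r: "r \<in> {0<..<pi/2}"
  shows "cos (lift_angle r \<phi>) = cos \<phi> * cos r"
    "sin (lift_angle r \<phi>) = sqrt (1 - (cos r)\<^sup>2 * (cos \<phi>)\<^sup>2)"
    "0 < lift_angle r \<phi>" "lift_angle r \<phi> < pi"
    "0 < sin (lift_angle r \<phi>)"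
proof -
  have b: "-1 < cos \<phi> * cos r" "cos \<phi> * cos r < 1"
    using abs_cos_less_1(3)[OF r, of \<phi>] by (simp_all add: abs_less_iff)
  show "cos (lift_angle r \<phi>) = cos \<phi> * cos r"
    using b by (simp add: lift_angle_def)
  show "sin (lift_angle r \<phi>) = sqrt (1 - (cos r)\<^sup>2 * (cos \<phi>)\<^sup>2)"
    using b by (simp add: lift_angle_def sin_arccos power_mult_distrib mult.commute)
  show p: "0 < lift_angle r \<phi>" "lift_angle r \<phi> < pi"
    using arccos_lt_bounded[OF b] by (auto simp: lift_angle_def)
  then show "0 < sin (lift_angle r \<phi>)" by (rule sin_gt_zero)
qed

lemma phi_map_eq:
  "r \<in> {0<..<pi/2} \<Longrightarrow>
    phi_map r \<phi> = \<phi> - cos r * sin \<phi> * (lift_angle r \<phi> / sin (lift_angle r \<phi>))"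
  by (simp add: phi_map_def lift_angle_facts(2))

lemma lift_angle_deriv:
  assumes r: "r \<in> {0<..<pi/2}"
  shows "(lift_angle r has_real_derivative cos r * sin \<phi> / sin (lift_angle r \<phi>)) (at \<phi>)"
proof -
  have b: "-1 < cos \<phi> * cos r" "cos \<phi> * cos r < 1"
    using abs_cos_less_1(3)[OF r, of \<phi>] by (simp_all add: abs_less_iff)
  have "((\<lambda>\<phi>. arccos (cos \<phi> * cos r)) has_real_derivative
      inverse (- sqrt (1 - (cos \<phi> * cos r)\<^sup>2)) * (- sin \<phi> * cos r)) (at \<phi>)"
    using b by (auto intro!: derivative_eq_intros)
  moreover have "inverse (- sqrt (1 - (cos \<phi> * cos r)\<^sup>2)) * (- sin \<phi> * cos r)
      = cos r * sin \<phi> / sin (lift_angle r \<phi>)"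
    by (simp add: lift_angle_facts(2)[OF r] power_mult_distrib divide_inverse mult.commute)
  ultimately show ?thesis by (simp add: lift_angle_def[abs_def])
qed

text \<open>The difference of the two sides vanishes at 0 and has derivative t sin t. It is the
  factor deciding the sign of the derivative of \<open>phi_map\<close>.\<close>

lemma mult_cos_less_sin:
  assumes "0 < t" "t < pi" shows "t * cos t < sin t"
proof -
  have "\<exists>y. ((\<lambda>t. sin t - t * cos t) has_real_derivative y) (at x) \<and> y > 0" if "0 < x" "x < t" for x
    using that assms
    by (intro exI[of _ "x * sin x"]) (auto intro!: derivative_eq_intros mult_pos_pos sin_gt_zero)
  then have "sin 0 - 0 * cos 0 < sin t - t * cos t"
    by (intro DERIV_pos_imp_increasing_open[OF assms(1)]) (auto intro!: continuous_intros)
  then show ?thesis by simp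
qed

text \<open>With \<theta> = \<open>lift_angle r \<phi>\<close> the derivative simplifies to (sin
  \<theta> - \<theta> cos \<theta>) sin(r)^2 / sin(\<theta>)^3, in which every factor is
  positive.\<close>

lemma phi_map_deriv_pos:
  assumes r: "r \<in> {0<..<pi/2}"
  shows "\<exists>y. (phi_map r has_real_derivative y) (at \<phi>) \<and> y > 0"
proof -
  let ?c = "cos r" and ?t = "lift_angle r \<phi>"
  define s where "s = sin (lift_angle r \<phi>)"
  note L = lift_angle_facts[OF r, of \<phi>]
  have s: "s > 0" using L by (simp add: s_def)
  have s2: "s\<^sup>2 = 1 - ?c\<^sup>2 * (cos \<phi>)\<^sup>2"
    using L(1) by (simp add: s_def sin_squared_eq power_mult_distrib mult.commute)
  have eq: "phi_map r = (\<lambda>\<phi>. \<phi> - cos r * sin \<phi> * (lift_angle r \<phi> / sin (lift_angle r \<phi>)))"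
    using phi_map_eq[OF r] by auto
  define D where "D = ?c * sin \<phi> / s"
  define y where "y = 1 - (?c * cos \<phi> * (?t / s) + ?c * sin \<phi> * ((D * s - ?t * (cos ?t * D)) / (s * s)))"
  have "(phi_map r has_real_derivative y) (at \<phi>)"
    unfolding eq y_def D_def s_def
    by (rule derivative_eq_intros lift_angle_deriv[OF r] refl | use s s_def in force)+ (simp add: mult.commute)
  moreover have "y = (s - ?t * cos ?t) * (sin r)\<^sup>2 / s ^ 3"
  proof -
    have "(sin r)\<^sup>2 = s\<^sup>2 - ?c\<^sup>2 * (sin \<phi>)\<^sup>2"
      by (simp add: s2 sin_squared_eq algebra_simps)
    then have "(s - ?t * cos ?t) * (sin r)\<^sup>2 = (s - ?t * cos ?t) * (s\<^sup>2 - ?c\<^sup>2 * (sin \<phi>)\<^sup>2)"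
      by simp
    also have "\<dots> = y * s ^ 3"
      using s unfolding y_def D_def L(1)
      by (simp add: field_simps power2_eq_square power3_eq_cube)
    finally show ?thesis using s by (simp add: field_simps)
  qed
  ultimately have "y > 0" "(phi_map r has_real_derivative y) (at \<phi>)"
    using mult_cos_less_sin[OF L(3,4)] s r sin_gt_zero[of r]
    by (auto intro!: divide_pos_pos mult_pos_pos simp: s_def mult.commute)
  then show ?thesis by blast
qed

lemma phi_map_strict_mono:
  assumes r: "r \<in> {0<..<pi/2}" and "x < y" shows "phi_map r x < phi_map r y"
  using assms phi_map_deriv_pos[OF r] by (intro DERIV_pos_imp_increasing[OF \<open>x < y\<close>]) blast

lemma phi_map_endpoints: "phi_map r 0 = 0" "phi_map r (-pi) = -pi"
  by (simp_all add: phi_map_def)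

lemma continuous_on_phi_map:
  "r \<in> {0<..<pi/2} \<Longrightarrow> continuous_on A (phi_map r)"
  by (meson DERIV_isCont continuous_at_imp_continuous_on phi_map_deriv_pos)

lemma inj_on_phi_map: "r \<in> {0<..<pi/2} \<Longrightarrow> inj_on (phi_map r) A"
  by (rule strict_mono_on_imp_inj_on) (simp add: strict_mono_on_def phi_map_strict_mono)

lemma ex1_is_phi:
  assumes r: "r \<in> {0<..<pi/2}" and \<eta>: "\<eta> \<in> {0..pi}"
  shows "\<exists>!\<phi>. is_phi r \<eta> \<phi>"
proof -
  have "\<exists>\<phi>\<ge>-pi. \<phi> \<le> 0 \<and> phi_map r \<phi> = - \<eta>"
    using \<eta> by (intro IVT' continuous_on_phi_map[OF r]) (auto simp: phi_map_endpoints)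
  then show ?thesis
    using inj_on_phi_map[OF r, of UNIV] unfolding is_phi_iff inj_on_def by auto
qed

section \<open>The solution \<open>phi\<close> as a function of \<eta>\<close>

lemma phi_facts:
  assumes r: "r \<in> {0<..<pi/2}" and \<eta>: "\<eta> \<in> {0..pi}"
  shows "phi r \<eta> \<in> {-pi..0}" "phi_map r (phi r \<eta>) = - \<eta>"
  using theI'[OF ex1_is_phi[OF assms], folded phi_def] by (simp_all add: is_phi_iff)

lemma phi_phi_map:
  assumes r: "r \<in> {0<..<pi/2}" and x: "x \<in> {-pi..0}"
  shows "- phi_map r x \<in> {0..pi}" "phi r (- phi_map r x) = x"
proof -
  have "phi_map r (-pi) \<le> phi_map r x" "phi_map r x \<le> phi_map r 0"
    using x phi_map_strict_mono[OF r] by (metis atLeastAtMost_iff linorder_not_le order_less_le)+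
  then show *: "- phi_map r x \<in> {0..pi}" by (simp add: phi_map_endpoints)
  show "phi r (- phi_map r x) = x"
    using phi_facts(2)[OF r *] inj_on_phi_map[OF r, of UNIV] by (auto simp: inj_on_def)
qed

text \<open>\<open>phi r\<close> inverts a continuous injection of a compact interval.\<close>

lemma continuous_on_phi:
  assumes r: "r \<in> {0<..<pi/2}"
  shows "continuous_on {0..pi} (phi r)"
proof -
  have "(\<lambda>x. - phi_map r x) ` {-pi..0} = {0..pi}"
    using phi_phi_map(1)[OF r] phi_facts[OF r] by (force simp: image_iff)
  moreover have "continuous_on ((\<lambda>x. - phi_map r x) ` {-pi..0}) (phi r)"
    using phi_phi_map(2)[OF r]
    by (intro continuous_on_inv) (auto intro!: continuous_intros continuous_on_phi_map[OF r])
  ultimately show ?thesis by simp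
qed

text \<open>The end points -\<pi> and 0 solve the equation only for \<eta> = \<pi> and \<eta> =
  0.\<close>

lemma phi_bounds:
  assumes r: "r \<in> {0<..<pi/2}" and \<eta>: "\<eta> \<in> {0<..<pi}"
  shows "-pi < phi r \<eta>" "phi r \<eta> < 0" "sin (phi r \<eta>) \<noteq> 0"
proof -
  show *: "-pi < phi r \<eta>" "phi r \<eta> < 0"
    using phi_facts[OF r, of \<eta>] \<eta> phi_map_endpoints[of r]
    by (cases "phi r \<eta> = -pi"; cases "phi r \<eta> = 0"; force)+
  then show "sin (phi r \<eta>) \<noteq> 0" using sin_gt_zero[of "- phi r \<eta>"] by auto
qed

text \<open>For positive \<open>r\<close> this is the stated formula with
  \<open>phi r \<eta> + \<eta>\<close> replaced by means of the equation for \<phi>. Its denominator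
  stays positive at \<eta> = 0 and \<eta> = \<pi>, where \<open>dist_sq_formula\<close> degenerates,
  so the limits there follow from continuity.\<close>

definition dist_fun :: "real \<Rightarrow> real \<Rightarrow> real" where
  "dist_fun r \<eta> = (if r = 0 then sqrt (2 * pi * \<eta> - \<eta>\<^sup>2)
     else lift_angle r (phi r \<eta>) * sin r / sin (lift_angle r (phi r \<eta>)))"

lemma dist_fun_sq_0: "\<eta> \<in> {0..pi} \<Longrightarrow> (dist_fun 0 \<eta>)\<^sup>2 = 2 * pi * \<eta> - \<eta>\<^sup>2"
proof -
  assume "\<eta> \<in> {0..pi}"
  then have "0 \<le> \<eta> * (2 * pi - \<eta>)" by (intro mult_nonneg_nonneg) auto
  then show ?thesis by (simp add: dist_fun_def algebra_simps power2_eq_square)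
qed

lemma phi_add:
  assumes r: "r \<in> {0<..<pi/2}" and \<eta>: "\<eta> \<in> {0..pi}"
  shows "phi r \<eta> + \<eta> = cos r * sin (phi r \<eta>) * (lift_angle r (phi r \<eta>) / sin (lift_angle r (phi r \<eta>)))"
  using phi_facts(2)[OF assms] unfolding phi_map_eq[OF r] by linarith

text \<open>Dividing the equation for \<phi> by sin \<phi> leaves a factor cos r, which cancels
  against tan r.\<close>

lemma dist_fun_sq:
  assumes r: "r \<in> {0<..<pi/2}" and \<eta>: "\<eta> \<in> {0<..<pi}"
  shows "(dist_fun r \<eta>)\<^sup>2 = dist_sq_formula r \<eta>"
proof -
  have "cos r \<noteq> 0" "r \<noteq> 0" using abs_cos_less_1[OF r] r by auto
  then show ?thesis
    using phi_add[OF r, of \<eta>] phi_bounds(3)[OF r \<eta>] \<eta>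
    by (simp add: dist_sq_formula_def dist_fun_def tan_def power_mult_distrib power_divide)
qed

lemma continuous_on_dist_fun:
  assumes r: "r \<in> {0<..<pi/2}"
  shows "continuous_on {0..pi} (dist_fun r)"
proof -
  have "continuous_on A (lift_angle r)" for A
    by (meson DERIV_isCont continuous_at_imp_continuous_on lift_angle_deriv[OF r])
  then have "continuous_on {0..pi} (\<lambda>\<eta>. lift_angle r (phi r \<eta>))"
    by (rule continuous_on_compose2[OF _ continuous_on_phi[OF r]]) auto
  then have "continuous_on {0..pi} (\<lambda>\<eta>. lift_angle r (phi r \<eta>) * sin r / sin (lift_angle r (phi r \<eta>)))"
    using lift_angle_facts(5)[OF r] by (intro continuous_intros) (auto simp: less_le)
  then show ?thesis using r by (simp add: dist_fun_def[abs_def])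
qed

lemma dist_sq_formula_limit:
  assumes r: "r \<in> {0<..<pi/2}" and \<eta>: "\<eta> \<in> {0, pi}"
  shows "(dist_sq_formula r \<longlongrightarrow> (dist_fun r \<eta>)\<^sup>2) (at \<eta> within {0..pi})"
proof -
  have "((\<lambda>\<eta>. (dist_fun r \<eta>)\<^sup>2) \<longlongrightarrow> (dist_fun r \<eta>)\<^sup>2) (at \<eta> within {0..pi})"
    using continuous_on_dist_fun[OF r] \<eta> by (intro tendsto_intros) (auto simp: continuous_on_def)
  moreover have "\<forall>\<^sub>F x in at \<eta> within {0..pi}. (dist_fun r x)\<^sup>2 = dist_sq_formula r x"
    unfolding eventually_at using \<eta> dist_fun_sq[OF r]
    \<comment> \<open>Radius \<pi> around one end point just excludes the other.\<close>
    by (intro exI[of _ pi]) (auto simp: dist_real_def)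
  ultimately show ?thesis by (rule Lim_transform_eventually)
qed

section \<open>Geodesics\<close>

text \<open>For a unit \<open>k\<close>, the embedding of the complex numbers as the subalgebra
  spanned by 1 and \<open>k\<close>.\<close>

definition qc :: "real ^ 3 \<Rightarrow> complex \<Rightarrow> quat" where
  "qc k z = (Re z, Im z *\<^sub>R k)"

lemma qc_add: "qc k (z + w) = qc k z + qc k w"
  and qc_scale: "qc k (c *\<^sub>R z) = c *\<^sub>R qc k z"
  and qcnj_qc: "qcnj (qc k z) = qc k (cnj z)"
  and qc_0 [simp]: "qc k 0 = 0"
  and qc_of_real: "qc k (of_real c) = (c, 0)"
  by (simp_all add: qc_def qcnj_def scaleR_left_distrib prod_eq_iff)

lemma qc_mult: "norm k = 1 \<Longrightarrow> qmult (qc k z) (qc k w) = qc k (z * w)"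
  by (simp add: qc_def qmult_def cross_mult_left cross_mult_right dot_square_norm scaleR_left_distrib mult.commute)

lemma norm_qc: "norm k = 1 \<Longrightarrow> norm (qc k z) = cmod z"
  by (simp add: qc_def norm_Pair cmod_def)

lemma bounded_linear_qaction_qc: "bounded_linear (\<lambda>z. qaction (qc k z) x)"
  unfolding linear_conv_bounded_linear[symmetric]
  by (intro linearI) (simp_all add: qc_add qc_scale qaction_add_left qaction_scale_left)

lemma qaction_0 [simp]: "qaction 0 x = 0"
  using qaction_scalar[of 0 x] by (simp add: zero_prod_def)

context
  fixes x e :: "'n::finite hspace"
  assumes x: "norm x = 1" and e: "norm e = 1" and orth: "\<And>g. inner (qaction g x) e = 0"
begin

text \<open>The quaternionic lines of \<open>x\<close> and \<open>e\<close> are orthogonal, so pairs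
  of quaternions embed isometrically and all computations below take place in the
  coefficients.\<close>

lemma inner_frame:
  "inner (qaction a x + qaction b e) (qaction c x + qaction d e) = inner a c + inner b d"
proof -
  have o: "inner (qaction g x) (qaction h e) = 0" for g h
    using orth[of "qmult (qcnj h) g"] inner_qaction[of h e "qaction g x"]
    by (simp add: qaction_qaction inner_commute)
  have "inner x x = 1" "inner e e = 1" using x e by (simp_all add: dot_square_norm)
  then show ?thesis
    using o[of a d] o[of c b] by (simp add: inner_add inner_qaction_qaction inner_commute)
qed

text \<open>In the complex plane of \<open>\<real>[k]\<close>, the curve is a great circle of speed \<open>\<theta>\<close> turned back by
  \<open>cis (- \<theta> \<alpha> t)\<close>, which removes exactly its vertical velocity.\<close>

lemma sR_dist_le_frame:
  assumes k: "norm k = 1" and ab: "\<alpha>\<^sup>2 + \<beta>\<^sup>2 = 1" and \<beta>: "\<beta> \<ge> 0" and \<theta>: "\<theta> \<ge> 0"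
  shows "sR_dist x (qaction (qc k (cis (- (\<theta> * \<alpha>)) * Complex (cos \<theta>) (\<alpha> * sin \<theta>))) x
      + qaction (qc k (cis (- (\<theta> * \<alpha>)) * of_real (\<beta> * sin \<theta>))) e) \<le> ereal (\<theta> * \<beta>)"
proof -
  \<comment> \<open>\<open>A\<close> and \<open>B\<close> are the coefficients along
    \<open>x\<close> and \<open>e\<close> of the great circle with initial velocity
    \<theta>(\<alpha>kx + \<beta>e), turned back. In \<open>A'\<close> and \<open>B'\<close> the
    common phase is factored out.\<close>
  define A where "A t = cis (- (\<theta> * \<alpha>) * t) * Complex (cos (\<theta> * t)) (\<alpha> * sin (\<theta> * t))" for t
  define B where "B t = cis (- (\<theta> * \<alpha>) * t) * of_real (\<beta> * sin (\<theta> * t))" for t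
  define A' where "A' t = cis (- (\<theta> * \<alpha>) * t) * of_real (\<theta> * (\<alpha>\<^sup>2 - 1) * sin (\<theta> * t))" for t
  define B' where "B' t = cis (- (\<theta> * \<alpha>) * t) * Complex (\<theta> * \<beta> * cos (\<theta> * t)) (- \<theta> * \<alpha> * \<beta> * sin (\<theta> * t))" for t
  have dA: "(A has_vector_derivative A' t) (at t)" for t
    unfolding has_vector_derivative_complex_iff A_def A'_def
    by (auto intro!: derivative_eq_intros simp: algebra_simps power2_eq_square)
  have dB: "(B has_vector_derivative B' t) (at t)" for t
    unfolding has_vector_derivative_complex_iff B_def B'_def
    by (auto intro!: derivative_eq_intros simp: algebra_simps power2_eq_square)
  define \<gamma> where "\<gamma> t = qaction (qc k (A t)) x + qaction (qc k (B t)) e" for t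
  define \<gamma>' where "\<gamma>' t = qaction (qc k (A' t)) x + qaction (qc k (B' t)) e" for t
  have d\<gamma>: "(\<gamma> has_vector_derivative \<gamma>' t) (at t)" for t
    unfolding \<gamma>_def \<gamma>'_def
    by (intro has_vector_derivative_add bounded_linear.has_vector_derivative[OF bounded_linear_qaction_qc] dA dB)
  have nrm: "norm (qaction (qc k z) x + qaction (qc k w) e) = sqrt ((cmod z)\<^sup>2 + (cmod w)\<^sup>2)" for z w
    unfolding norm_eq_sqrt_inner[of "_ + _"] inner_frame by (simp add: dot_square_norm norm_qc[OF k])
  have sc: "(cos (\<theta> * t))\<^sup>2 = 1 - (sin (\<theta> * t))\<^sup>2" for t by (simp add: cos_squared_eq)
  have b2: "\<beta>\<^sup>2 = 1 - \<alpha>\<^sup>2" using ab by simp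
  have unit: "norm (\<gamma> t) = 1" for t
  proof -
    have "(cmod (A t))\<^sup>2 + (cmod (B t))\<^sup>2 = 1"
      unfolding A_def B_def norm_mult cmod_power2[of "Complex _ _"] norm_cis
      by (simp add: cmod_power2 power_mult_distrib sc b2 algebra_simps)
    then show ?thesis unfolding \<gamma>_def nrm by simp
  qed
  have speed: "norm (\<gamma>' t) = \<theta> * \<beta>" for t
  proof -
    have "(cmod (A' t))\<^sup>2 + (cmod (B' t))\<^sup>2 = (\<theta> * \<beta>)\<^sup>2"
      unfolding A'_def B'_def norm_mult norm_cis
      by (simp add: cmod_power2 power_mult_distrib sc b2 algebra_simps power2_diff) (simp add: power2_eq_square algebra_simps)
    then show ?thesis unfolding \<gamma>'_def nrm using \<beta> \<theta> by simp
  qed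
  have vert: "inner (qaction g (\<gamma> t)) (\<gamma>' t) = 0" for g t
  proof -
    have cc: "cis a * z * cnj (cis a * w) = z * cnj w" for a z w
      by (simp add: cis_cnj mult.assoc mult.left_commute[of _ "cis (- a)"]) (simp add: mult.assoc[symmetric] cis_mult)
    \<comment> \<open>This number is the whole vertical component of the velocity. The common phases
      cancel, and what remains has the factor
      \<open>\<alpha>\<^sup>2 + \<beta>\<^sup>2 - 1\<close>.\<close>
    have "A' t * cnj (A t) + B' t * cnj (B t) =
        of_real (\<alpha>\<^sup>2 + \<beta>\<^sup>2 - 1) * Complex (\<theta> * sin (\<theta> * t) * cos (\<theta> * t)) (- \<theta> * \<alpha> * (sin (\<theta> * t))\<^sup>2)"
      unfolding A_def B_def A'_def B'_def cc
      by (simp add: complex_eq_iff power2_eq_square algebra_simps)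
    then have "A' t * cnj (A t) + B' t * cnj (B t) = 0" using ab by simp
    moreover have "inner (qaction g (\<gamma> t)) (\<gamma>' t) = inner g (qc k (A' t * cnj (A t) + B' t * cnj (B t)))"
      unfolding \<gamma>_def \<gamma>'_def qaction_add_right qaction_qaction inner_frame
      by (simp add: inner_qmult_right qcnj_qc qc_mult[OF k] qc_add inner_add_right)
    ultimately show ?thesis by simp
  qed
  have hs: "\<gamma>' t \<in> horizontal_space (\<gamma> t)" for t
    by (rule in_horizontal_space[OF unit d\<gamma> vert])
  have lip: "norm (\<gamma> t - \<gamma> s) \<le> (\<theta> * \<beta>) * \<bar>t - s\<bar>" for s t
    using differentiable_bound[of UNIV \<gamma> "\<lambda>t h. h *\<^sub>R \<gamma>' t" "\<theta> * \<beta>" t s] d\<gamma> speed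
    by (auto simp: has_vector_derivative_def onorm_scaleR_left[OF bounded_linear_ident] onorm_id intro!: onorm_le)
  have "AE t in lebesgue_on {0..1}. \<exists>v \<in> horizontal_space (\<gamma> t). (\<gamma> has_vector_derivative v) (at t within {0..1})"
    using hs has_vector_derivative_at_within[OF d\<gamma>] by (intro AE_I2) blast
  moreover have "path_image \<gamma> \<subseteq> sphere 0 1" using unit by (auto simp: path_image_def)
  ultimately have "horizontal_curve \<gamma>"
    unfolding horizontal_curve_def using lipschitz_abs_continuous[OF lip] by blast
  moreover have "curve_length \<gamma> = \<theta> * \<beta>"
  proof -
    have "vector_derivative \<gamma> (at t within {0..1}) = \<gamma>' t" if "t \<in> {0..1}" for t
      using that has_vector_derivative_at_within[OF d\<gamma>] by (intro vector_derivative_within_closed_interval) auto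
    then have "curve_length \<gamma> = integral {0..1} (\<lambda>t::real. \<theta> * \<beta>)"
      unfolding curve_length_def by (intro Henstock_Kurzweil_Integration.integral_cong) (simp add: speed)
    then show ?thesis by simp
  qed
  moreover have "pathstart \<gamma> = x"
    using qaction_scalar[of 1 x] by (simp add: pathstart_def \<gamma>_def A_def B_def qc_def zero_prod_def[symmetric])
  ultimately have "sR_dist x (\<gamma> 1) \<le> ereal (\<theta> * \<beta>)"
    unfolding sR_dist_def by (intro INF_lower2[of \<gamma>]) (auto simp: pathfinish_def)
  then show ?thesis by (simp add: \<gamma>_def A_def B_def)
qed

end

text \<open>\<open>\<theta>\<close> is the length of the great circle arc and \<open>\<alpha>\<close>, \<open>\<beta>\<close> are the vertical and horizontal parts of its
  unit direction; the arc ends over the point with cylindric coordinates \<open>(r, \<eta> + \<theta>\<alpha>)\<close>.\<close>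

definition geodesic_params :: "real \<Rightarrow> real \<Rightarrow> real \<Rightarrow> real \<Rightarrow> real \<Rightarrow> bool" where
  "geodesic_params r \<eta> \<theta> \<alpha> \<beta> \<longleftrightarrow> \<theta> \<in> {0..pi} \<and> \<alpha>\<^sup>2 + \<beta>\<^sup>2 = 1 \<and> \<beta> \<ge> 0 \<and>
     cos \<theta> = cos r * cos (\<eta> + \<theta> * \<alpha>) \<and> \<alpha> * sin \<theta> = cos r * sin (\<eta> + \<theta> * \<alpha>) \<and> \<beta> * sin \<theta> = sin r"

lemma geodesic_params_length:
  assumes "geodesic_params r \<eta> \<theta> \<alpha> \<beta>"
  shows "0 \<le> \<theta> * \<beta>" "\<theta> * \<beta> \<le> pi"
proof -
  have "\<beta>\<^sup>2 \<le> 1\<^sup>2" "\<beta> \<ge> 0"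
    using assms zero_le_power2[of \<alpha>] unfolding geodesic_params_def one_power2 by linarith+
  then have "\<beta> \<le> 1" using power2_le_imp_le[of \<beta> 1] by simp
  then show "0 \<le> \<theta> * \<beta>" "\<theta> * \<beta> \<le> pi"
    using assms mult_mono[of \<theta> pi \<beta> 1] by (auto simp: geodesic_params_def)
qed

lemma geodesic_params_exist:
  assumes r: "r \<in> {0..<pi/2}" and \<eta>: "\<eta> \<in> {0..pi}"
  obtains \<theta> \<alpha> \<beta> where "geodesic_params r \<eta> \<theta> \<alpha> \<beta>" "\<theta> * \<beta> = dist_fun r \<eta>"
proof (cases "r = 0")
  case True
  \<comment> \<open>Over \<open>r = 0\<close> the arc is half a great circle, which ends at the
    antipode in every direction; \<alpha> is chosen so that \<eta> + \<pi>\<alpha> = \<pi>.\<close>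
  define \<alpha> where "\<alpha> = (pi - \<eta>) / pi"
  define \<beta> where "\<beta> = sqrt (1 - \<alpha>\<^sup>2)"
  have a: "0 \<le> \<alpha>" "\<alpha> \<le> 1" using \<eta> by (auto simp: \<alpha>_def)
  then have a2: "\<alpha>\<^sup>2 \<le> 1" by (simp add: power_le_one)
  have mu: "pi * \<alpha> = pi - \<eta>" by (simp add: \<alpha>_def)
  have "geodesic_params r \<eta> pi \<alpha> \<beta>"
    unfolding geodesic_params_def mu using True a2 by (simp add: \<beta>_def)
  moreover have "pi * \<beta> = dist_fun r \<eta>"
  proof -
    have "pi * \<beta> = sqrt (pi\<^sup>2 * (1 - \<alpha>\<^sup>2))" by (simp add: \<beta>_def real_sqrt_mult)
    also have "pi\<^sup>2 * (1 - \<alpha>\<^sup>2) = pi\<^sup>2 - (pi * \<alpha>)\<^sup>2" by (simp add: algebra_simps power_mult_distrib)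
    also have "\<dots> = 2 * pi * \<eta> - \<eta>\<^sup>2" unfolding mu by (simp add: power2_eq_square algebra_simps)
    finally show ?thesis using True by (simp add: dist_fun_def)
  qed
  ultimately show ?thesis by (rule that)
next
  case False
  then have r': "r \<in> {0<..<pi/2}" using r by auto
  define \<phi> where "\<phi> = phi r \<eta>"
  define \<theta> where "\<theta> = lift_angle r \<phi>"
  note L = lift_angle_facts[OF r', of \<phi>, folded \<theta>_def]
  \<comment> \<open>Solved from the last two equations of \<open>geodesic_params\<close> with \<eta>
    + \<theta>\<alpha> = -\<phi>; the equation for \<phi> says exactly that this angle is
    consistent.\<close>
  define \<alpha> \<beta> where "\<alpha> = - cos r * sin \<phi> / sin \<theta>" and "\<beta> = sin r / sin \<theta>"
  have "\<theta> * \<alpha> = - (\<phi> + \<eta>)"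
    using phi_add[OF r' \<eta>] by (simp add: \<alpha>_def \<phi>_def \<theta>_def)
  then have mu: "\<eta> + \<theta> * \<alpha> = - \<phi>" by simp
  have "(sin \<theta>)\<^sup>2 = 1 - (cos \<phi> * cos r)\<^sup>2" using L(1) by (simp add: sin_squared_eq)
  also have "\<dots> = (cos r * sin \<phi>)\<^sup>2 + (sin r)\<^sup>2"
    by (simp add: power_mult_distrib sin_squared_eq algebra_simps)
  finally have s2: "(sin \<theta>)\<^sup>2 = (cos r * sin \<phi>)\<^sup>2 + (sin r)\<^sup>2" .
  have "\<alpha>\<^sup>2 + \<beta>\<^sup>2 = ((cos r * sin \<phi>)\<^sup>2 + (sin r)\<^sup>2) / (sin \<theta>)\<^sup>2"
    by (simp add: \<alpha>_def \<beta>_def power_divide add_divide_distrib)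
  then have "\<alpha>\<^sup>2 + \<beta>\<^sup>2 = 1" using L(5) by (simp flip: s2)
  moreover have "sin r \<ge> 0" using r' by (intro sin_ge_zero) auto
  ultimately have "geodesic_params r \<eta> \<theta> \<alpha> \<beta>"
    unfolding geodesic_params_def mu using L by (simp add: \<alpha>_def \<beta>_def mult.commute)
  moreover have "\<theta> * \<beta> = dist_fun r \<eta>"
    using False by (simp add: dist_fun_def \<theta>_def \<beta>_def \<phi>_def)
  ultimately show ?thesis by (rule that)
qed

section \<open>Polar form of a quaternion, adapted frames and the upper bound\<close>

lemma quat_polar:
  fixes q :: quat
  assumes q: "norm q = c" "fst q = c * cos \<eta>" and \<eta>: "\<eta> \<in> {0..pi}"
  obtains k where "norm k = 1" "q = qc k (of_real c * cis \<eta>)"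
proof -
  have c: "c \<ge> 0" using q(1) norm_ge_zero by metis
  have s: "sin \<eta> \<ge> 0" using \<eta> by (auto intro: sin_ge_zero)
  have "(norm q)\<^sup>2 = (fst q)\<^sup>2 + (norm (snd q))\<^sup>2" by (simp add: norm_prod_def)
  then have "(norm (snd q))\<^sup>2 = c\<^sup>2 - (c * cos \<eta>)\<^sup>2" using q by simp
  also have "\<dots> = (c * sin \<eta>)\<^sup>2" by (simp add: power_mult_distrib sin_squared_eq algebra_simps)
  finally have n: "norm (snd q) = c * sin \<eta>" using c s by simp
  show ?thesis
  proof (cases "snd q = 0")
    case True
    then have "c * sin \<eta> = 0" using n by simp
    \<comment> \<open>A real quaternion has no preferred imaginary direction, and any unit vector
      serves.\<close>
    then have "q = qc (axis 1 1) (of_real c * cis \<eta>)"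
      using q True by (simp add: qc_def prod_eq_iff)
    then show ?thesis using that[of "axis 1 1"] by simp
  next
    case False
    then have "c * sin \<eta> \<noteq> 0" using n by (metis norm_eq_zero)
    then have "(c * sin \<eta>) *\<^sub>R (snd q /\<^sub>R (c * sin \<eta>)) = snd q"
      by (metis scaleR_scaleR right_inverse scaleR_one)
    moreover have "Re (of_real c * cis \<eta>) = fst q" "Im (of_real c * cis \<eta>) = c * sin \<eta>"
      using q(2) by simp_all
    ultimately have "q = qc (snd q /\<^sub>R norm (snd q)) (of_real c * cis \<eta>)"
      unfolding qc_def n by (metis prod.collapse)
    then show ?thesis using that[of "snd q /\<^sub>R norm (snd q)"] False by simp
  qed
qed

text \<open>\<open>e\<close> is the normalised remainder of \<open>y\<close> after projection onto
  the quaternionic line of \<open>x\<close>.\<close>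

lemma orthogonal_frame_exists:
  fixes x y :: "'n::finite hspace"
  assumes x: "norm x = 1" and y: "norm y = 1"
  obtains e where "norm e = 1" "\<And>g. inner (qaction g x) e = 0"
    "y = qaction (qinner y x) x + sqrt (1 - (norm (qinner y x))\<^sup>2) *\<^sub>R e"
proof -
  define w where "w = y - qaction (qinner y x) x"
  have xx: "inner x x = 1" using x by (simp add: dot_square_norm)
  have ow: "inner (qaction g x) w = 0" for g
    by (simp add: w_def inner_diff_right inner_qaction_left[of g x y] inner_qaction_qaction xx)
  have "(norm y)\<^sup>2 = (norm (qaction (qinner y x) x + w))\<^sup>2" by (simp add: w_def)
  also have "\<dots> = (norm (qinner y x))\<^sup>2 + (norm w)\<^sup>2"
    using ow[of "qinner y x"] by (simp add: power2_norm_eq_inner inner_add inner_qaction_qaction xx inner_commute)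
  finally have nw: "norm w = sqrt (1 - (norm (qinner y x))\<^sup>2)" using y by (intro real_sqrt_unique[symmetric]) auto
  show ?thesis
  proof (cases "w = 0")
    case False
    show ?thesis
      by (rule that[of "w /\<^sub>R norm w"]) (use False ow in \<open>simp_all add: nw[symmetric] w_def\<close>)
  next
    case True
    \<comment> \<open>Without a remainder any unit vector orthogonal to the line will do. One exists
      because the line has real dimension at most 4 and the ambient space has more.\<close>
    let ?S = "range (\<lambda>g. qaction g x)"
    have lin: "linear (\<lambda>g. qaction g x)"
      by (intro linearI) (simp_all add: qaction_add_left qaction_scale_left)
    have "dim ?S \<le> dim (UNIV :: quat set)" by (rule dim_image_le[OF lin])
    also have "\<dots> < DIM('n hspace)" by simp
    finally obtain u where u: "u \<noteq> 0" "\<And>z. z \<in> span ?S \<Longrightarrow> orthogonal u z"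
      using orthogonal_to_subspace_exists[of ?S] by blast
    have "inner (qaction g x) u = 0" for g
      using u(2)[of "qaction g x"] by (simp add: span_base orthogonal_def inner_commute)
    then show ?thesis
      using True nw u(1) by (intro that[of "u /\<^sub>R norm u"]) (simp_all add: w_def)
  qed
qed

lemma sR_dist_le:
  fixes x y :: "'n::finite hspace"
  assumes x: "norm x = 1" and y: "norm y = 1"
    and q: "norm (qinner y x) = cos r" "fst (qinner y x) = cos r * cos \<eta>" and \<eta>: "\<eta> \<in> {0..pi}"
    and p: "geodesic_params r \<eta> \<theta> \<alpha> \<beta>"
  shows "sR_dist x y \<le> ereal (\<theta> * \<beta>)"
proof -
  obtain k where k: "norm k = 1" "qinner y x = qc k (of_real (cos r) * cis \<eta>)"
    using quat_polar[OF q \<eta>] by blast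
  obtain e where e: "norm e = 1" "\<And>g. inner (qaction g x) e = 0"
    "y = qaction (qinner y x) x + sqrt (1 - (norm (qinner y x))\<^sup>2) *\<^sub>R e"
    using orthogonal_frame_exists[OF x y] by blast
  let ?m = "\<theta> * \<alpha>"
  \<comment> \<open>Turning \<open>e\<close> in advance undoes the phase that the end point of the
    frame curve carries along \<open>e\<close>.\<close>
  define e' where "e' = qaction (qc k (cis ?m)) e"
  have e': "norm e' = 1" by (simp add: e'_def norm_qaction norm_qc k e)
  have oe': "inner (qaction g x) e' = 0" for g
    using e(2)[of "qmult (qcnj (qc k (cis ?m))) g"] inner_qaction[of "qc k (cis ?m)" e "qaction g x"]
    by (simp add: e'_def qaction_qaction inner_commute)
  have "sin r = \<beta> * sin \<theta>" "\<beta> \<ge> 0" "sin \<theta> \<ge> 0"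
    using p sin_ge_zero[of \<theta>] by (auto simp: geodesic_params_def)
  then have "sin r = \<beta> * sin \<theta>" "\<beta> * sin \<theta> \<ge> 0" by simp_all
  then have sr: "sqrt (1 - (norm (qinner y x))\<^sup>2) = \<beta> * sin \<theta>"
    unfolding q by (simp flip: sin_squared_eq)
  have "Complex (cos \<theta>) (\<alpha> * sin \<theta>) = of_real (cos r) * cis (\<eta> + ?m)"
    using p by (simp add: geodesic_params_def complex_eq_iff)
  then have "cis (- ?m) * Complex (cos \<theta>) (\<alpha> * sin \<theta>) = of_real (cos r) * (cis (- ?m) * cis (\<eta> + ?m))"
    by simp
  also have "cis (- ?m) * cis (\<eta> + ?m) = cis \<eta>" by (simp add: cis_mult)
  finally have A: "cis (- ?m) * Complex (cos \<theta>) (\<alpha> * sin \<theta>) = of_real (cos r) * cis \<eta>" .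
  have "cis (- ?m) * of_real (\<beta> * sin \<theta>) * cis ?m = of_real (\<beta> * sin \<theta>) * (cis (- ?m) * cis ?m)"
    by (simp add: mult_ac)
  also have "\<dots> = of_real (\<beta> * sin \<theta>)" by (simp add: cis_mult)
  finally have "qaction (qc k (cis (- ?m) * of_real (\<beta> * sin \<theta>))) e' = (\<beta> * sin \<theta>) *\<^sub>R e"
    unfolding e'_def qaction_qaction qc_mult[OF k(1)] by (simp only: qc_of_real qaction_scalar)
  then have "y = qaction (qc k (cis (- ?m) * Complex (cos \<theta>) (\<alpha> * sin \<theta>))) x
      + qaction (qc k (cis (- ?m) * of_real (\<beta> * sin \<theta>))) e'"
    using e(3) unfolding sr by (simp only: A k(2)[symmetric])
  then show ?thesis
    using sR_dist_le_frame[OF x e' oe' k(1), of \<alpha> \<beta> \<theta>] p by (auto simp: geodesic_params_def)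
qed

section \<open>The lower bound at the north pole\<close>

lemma qinner_north_pole: "qinner y north_pole = snd y"
  by (simp add: qinner_def north_pole_def qcnj_def qmult_1_right) (simp add: qmult_def flip: zero_prod_def)

lemma norm_north_pole: "norm north_pole = 1"
  by (simp add: north_pole_def norm_Pair)

text \<open>Choosing \<kappa>L = \<theta>\<alpha> turns the end point into one at great circle
  distance \<theta>, whence \<theta>^2 is at most L^2 + (\<theta>\<alpha>)^2. The claim follows
  because \<theta>^2 - (\<theta>\<alpha>)^2 = (\<theta>\<beta>)^2.\<close>

lemma curve_length_ge:
  fixes \<gamma> :: "real \<Rightarrow> 'n::finite hspace"
  assumes h: "horizontal_curve \<gamma>" and s: "pathstart \<gamma> = north_pole"
    and cyl: "cylindric_coords (pathfinish \<gamma>) r \<eta>"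
    and p: "geodesic_params r \<eta> \<theta> \<alpha> \<beta>"
  shows "\<theta> * \<beta> \<le> curve_length \<gamma>"
proof -
  define L where "L = curve_length \<gamma>"
  obtain k where k: "norm k = 1" "snd (\<gamma> 1) = qc k (of_real (cos r) * cis \<eta>)"
    using cyl quat_polar[of "snd (\<gamma> 1)" "cos r" \<eta>] by (auto simp: cylindric_coords_def pathfinish_def)
  have ip: "inner (\<gamma> 0) (qaction (cos a, sin a *\<^sub>R k) (\<gamma> 1)) = cos r * cos (\<eta> + a)" for a
  proof -
    have "inner (\<gamma> 0) (qaction (cos a, sin a *\<^sub>R k) (\<gamma> 1)) = fst (qmult (qc k (cis a)) (snd (\<gamma> 1)))"
      using s by (simp add: pathstart_def north_pole_def qaction_def inner_prod_def qc_def)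
    also have "\<dots> = cos r * cos (\<eta> + a)"
      unfolding k(2) qc_mult[OF k(1)] by (simp add: qc_def cos_add algebra_simps)
    finally show ?thesis .
  qed
  note bound = horizontal_curve_bound[OF h k(1), folded L_def, unfolded ip]
  have \<theta>: "\<theta> \<in> {0..pi}" "cos \<theta> = cos r * cos (\<eta> + \<theta> * \<alpha>)" and ab: "\<alpha>\<^sup>2 + \<beta>\<^sup>2 = 1" "\<beta> \<ge> 0"
    using p by (auto simp: geodesic_params_def)
  have "\<theta>\<^sup>2 \<le> L\<^sup>2 + (\<theta> * \<alpha>)\<^sup>2"
  proof (cases "L = 0")
    case False
    then have "L > 0" using bound(1) by simp
    have "arccos (cos \<theta>) \<le> sqrt (1 + (\<theta> * \<alpha> / L)\<^sup>2) * L"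
      using bound(2)[of "\<theta> * \<alpha> / L"] False \<theta>(2) by simp
    then have "\<theta> \<le> sqrt (1 + (\<theta> * \<alpha> / L)\<^sup>2) * L" using \<theta>(1) by (simp add: arccos_cos)
    then have "\<theta>\<^sup>2 \<le> (sqrt (1 + (\<theta> * \<alpha> / L)\<^sup>2) * L)\<^sup>2" using \<theta>(1) by (intro power_mono) auto
    also have "\<dots> = (1 + (\<theta> * \<alpha> / L)\<^sup>2) * L\<^sup>2" by (simp add: power_mult_distrib)
    also have "\<dots> = L\<^sup>2 + (\<theta> * \<alpha>)\<^sup>2" using False by (simp add: field_simps)
    finally show ?thesis .
  next
    case True
    have r: "r \<in> {0..<pi/2}" and \<eta>: "\<eta> \<in> {0..pi}" using cyl by (auto simp: cylindric_coords_def)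
    have b: "\<bar>cos r * cos \<eta>\<bar> \<le> 1" by (simp add: abs_mult mult_le_one)
    have "arccos (cos r * cos \<eta>) \<le> 0" using bound(2)[of 0] True by simp
    then have "arccos (cos r * cos \<eta>) = 0" using arccos_lbound[of "cos r * cos \<eta>"] b by (auto simp: abs_le_iff)
    then have one: "cos r * cos \<eta> = 1" using cos_arccos_abs[OF b] by simp
    have "cos r > 0" using r by (intro cos_gt_zero_pi) auto
    then have "\<not> cos \<eta> < 1"
      using one mult_strict_left_mono[of "cos \<eta>" 1 "cos r"] cos_le_one[of r] by auto
    then have c: "cos \<eta> = 1" "cos r = 1" using cos_le_one[of \<eta>] one by auto
    then have "sin \<eta> = 0" using sin_cos_squared_add[of \<eta>] by simp
    then have ce: "cos \<theta> = cos \<bar>\<theta> * \<alpha>\<bar>" using \<theta>(2) c by (simp add: cos_add)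
    have le: "\<bar>\<theta> * \<alpha>\<bar> \<le> pi"
    proof -
      have "\<alpha>\<^sup>2 \<le> 1\<^sup>2" using ab(1) zero_le_power2[of \<beta>] unfolding one_power2 by linarith
      then have "\<bar>\<alpha>\<bar> \<le> 1" by (simp add: abs_square_le_1)
      then show ?thesis using \<theta>(1) mult_mono[of \<theta> pi "\<bar>\<alpha>\<bar>" 1] by (simp add: abs_mult)
    qed
    have "\<theta> = \<bar>\<theta> * \<alpha>\<bar>"
      by (rule cos_inj_pi[OF _ _ abs_ge_zero le ce]) (use \<theta>(1) in auto)
    then have "\<theta>\<^sup>2 = (\<theta> * \<alpha>)\<^sup>2" by (metis power2_abs)
    then show ?thesis using zero_le_power2[of L] by linarith
  qed
  moreover have "(\<theta> * \<beta>)\<^sup>2 = \<theta>\<^sup>2 - (\<theta> * \<alpha>)\<^sup>2"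
  proof -
    have b2: "\<beta>\<^sup>2 = 1 - \<alpha>\<^sup>2" using ab by simp
    show ?thesis unfolding power_mult_distrib b2 by (simp add: algebra_simps)
  qed
  ultimately have "(\<theta> * \<beta>)\<^sup>2 \<le> L\<^sup>2" by simp
  then show ?thesis using bound(1) unfolding L_def[symmetric] by (rule power2_le_imp_le)
qed

theorem sR_dist_north_pole:
  fixes x :: "'n::finite hspace"
  assumes x: "x \<in> sphere 0 1" and cyl: "cylindric_coords x r \<eta>"
  shows "sR_dist north_pole x = ereal (dist_fun r \<eta>)"
proof -
  have r: "r \<in> {0..<pi/2}" and \<eta>: "\<eta> \<in> {0..pi}" using cyl by (auto simp: cylindric_coords_def)
  obtain \<theta> \<alpha> \<beta> where p: "geodesic_params r \<eta> \<theta> \<alpha> \<beta>" "\<theta> * \<beta> = dist_fun r \<eta>"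
    using geodesic_params_exist[OF r \<eta>] by blast
  show ?thesis
  proof (rule antisym)
    show "sR_dist north_pole x \<le> ereal (dist_fun r \<eta>)"
      using sR_dist_le[OF norm_north_pole _ _ _ \<eta> p(1), of x] x cyl p(2)
      by (simp add: qinner_north_pole cylindric_coords_def)
    show "ereal (dist_fun r \<eta>) \<le> sR_dist north_pole x"
      unfolding sR_dist_def
      using curve_length_ge[OF _ _ _ p(1)] cyl p(2) by (intro INF_greatest) auto
  qed
qed

text \<open>The coordinates of \<open>y\<close> relative to \<open>x\<close> are read off
  \<open>qinner y x\<close>, and the resulting curve has length \<theta>\<beta> with \<theta> at
  most \<pi> and \<beta> at most 1.\<close>

lemma sR_dist_le_pi:
  fixes x y :: "'n::finite hspace"
  assumes x: "norm x = 1" and y: "norm y = 1"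
  shows "sR_dist x y \<le> ereal pi"
proof -
  define q where "q = qinner y x"
  obtain e where "y = qaction q x + sqrt (1 - (norm q)\<^sup>2) *\<^sub>R e" "norm e = 1" "\<And>g. inner (qaction g x) e = 0"
    using orthogonal_frame_exists[OF x y] unfolding q_def by metis
  have "inner q q \<le> norm (qaction q x) * norm y"
    using norm_cauchy_schwarz[of "qaction q x" y] by (simp add: inner_qaction_left q_def)
  then have q1: "norm q \<le> 1"
    using x y by (cases "norm q = 0") (auto simp: norm_qaction dot_square_norm power2_eq_square)
  define r where "r = arccos (norm q)"
  have r: "cos r = norm q" using q1 by (simp add: r_def order_trans[of "-1" 0])
  define \<eta> where "\<eta> = (if q = 0 then 0 else arccos (fst q / norm q))"
  have f: "\<bar>fst q\<bar> \<le> norm q" using norm_fst_le[of "fst q" "snd q"] by simp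
  then have "-1 \<le> fst q / norm q" "fst q / norm q \<le> 1" if "q \<noteq> 0"
    using that by (auto simp: field_simps abs_le_iff)
  then have \<eta>: "\<eta> \<in> {0..pi}" "fst q = cos r * cos \<eta>"
    using arccos_bounded[of "fst q / norm q"] unfolding r by (auto simp: \<eta>_def)
  have "\<exists>\<theta> \<alpha> \<beta>. geodesic_params r \<eta> \<theta> \<alpha> \<beta>"
  proof (cases "q = 0")
    case True
    \<comment> \<open>Orthogonal quaternionic lines give r = \<pi>/2, outside the cylindric range; a
      quarter of a horizontal great circle joins the points.\<close>
    then have "geodesic_params r \<eta> (pi/2) 0 1" by (simp add: geodesic_params_def r_def)
    then show ?thesis by blast
  next
    case False
    then have "r \<in> {0..<pi/2}"
      using q1 arccos_less_mono[of "norm q" 0] arccos_lbound[of "norm q"] order_trans[of "-1" 0 "norm q"]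
      by (auto simp: r_def)
    then show ?thesis using geodesic_params_exist[OF _ \<eta>(1)] by metis
  qed
  then obtain \<theta> \<alpha> \<beta> where p: "geodesic_params r \<eta> \<theta> \<alpha> \<beta>" by blast
  have "sR_dist x y \<le> ereal (\<theta> * \<beta>)"
    using sR_dist_le[OF x y _ _ \<eta>(1) p] r \<eta>(2) by (simp add: q_def)
  also have "\<dots> \<le> ereal pi" using geodesic_params_length[OF p] by simp
  finally show ?thesis .
qed

text \<open>The bound \<pi> is attained by the north pole and its antipode, which has coordinates
  (0, \<pi>).\<close>

lemma sR_diameter_sphere: "sR_diameter (sphere (0 :: 'n::finite hspace) 1) = ereal pi"
proof (rule antisym)
  show "sR_diameter (sphere (0 :: 'n hspace) 1) \<le> ereal pi"
    unfolding sR_diameter_def by (intro SUP_least) (simp add: sR_dist_le_pi)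
  have "cylindric_coords (- north_pole :: 'n hspace) 0 pi"
    by (simp add: cylindric_coords_def north_pole_def norm_Pair)
  then have "sR_dist north_pole (- north_pole :: 'n hspace) = ereal (dist_fun 0 pi)"
    by (intro sR_dist_north_pole) (simp_all add: norm_north_pole)
  moreover have "dist_fun 0 pi = pi"
  proof -
    have "dist_fun 0 pi = sqrt (pi\<^sup>2)" by (simp add: dist_fun_def power2_eq_square)
    then show ?thesis by simp
  qed
  ultimately show "ereal pi \<le> sR_diameter (sphere (0 :: 'n hspace) 1)"
    unfolding sR_diameter_def
    by (intro SUP_upper2[of north_pole] SUP_upper2[of "- north_pole"]) (simp_all add: norm_north_pole)
qed

theorem mainTheorem11:
  shows "(\<exists>d :: real \<Rightarrow> real \<Rightarrow> real.
      (\<forall>(x :: 'n::finite hspace) r \<eta>.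
         x \<in> sphere 0 1 \<and> cylindric_coords x r \<eta> \<longrightarrow> sR_dist north_pole x = ereal (d r \<eta>)) \<and>
      (\<forall>\<eta> \<in> {0..pi}. (d 0 \<eta>)\<^sup>2 = 2 * pi * \<eta> - \<eta>\<^sup>2) \<and>
      (\<forall>\<eta> \<in> {0..pi}. \<forall>r \<in> {0<..<pi/2}.
         (\<exists>!\<phi>. is_phi r \<eta> \<phi>) \<and>
         (\<eta> \<in> {0<..<pi} \<longrightarrow>
            sin (phi r \<eta>) \<noteq> 0 \<and> (d r \<eta>)\<^sup>2 = dist_sq_formula r \<eta>) \<and>
         (\<eta> \<in> {0, pi} \<longrightarrow>
            (dist_sq_formula r \<longlongrightarrow> (d r \<eta>)\<^sup>2) (at \<eta> within {0..pi})))) \<and>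
    sR_diameter (sphere (0 :: 'n hspace) 1) = ereal pi"
proof (intro conjI exI[of _ dist_fun] allI ballI impI)
  show "sR_dist north_pole x = ereal (dist_fun r \<eta>)"
    if "x \<in> sphere 0 1 \<and> cylindric_coords x r \<eta>" for x :: "'n hspace" and r \<eta>
    using that sR_dist_north_pole by blast
next
  fix r \<eta> assume \<eta>: "\<eta> \<in> {0..pi}" and r: "r \<in> {0<..<pi/2}"
  show "\<exists>!\<phi>. is_phi r \<eta> \<phi>" by (rule ex1_is_phi[OF r \<eta>])
  show "sin (phi r \<eta>) \<noteq> 0" "(dist_fun r \<eta>)\<^sup>2 = dist_sq_formula r \<eta>" if "\<eta> \<in> {0<..<pi}"
    using phi_bounds(3)[OF r that] dist_fun_sq[OF r that] by auto
  show "(dist_sq_formula r \<longlongrightarrow> (dist_fun r \<eta>)\<^sup>2) (at \<eta> within {0..pi})" if "\<eta> \<in> {0, pi}"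
    by (rule dist_sq_formula_limit[OF r that])
qed (rule dist_fun_sq_0 sR_diameter_sphere; assumption?)+

end
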